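(* Consider the system $x_{t+1}=Ax_t+Bu_t+w_t$, $t\ge 0$, $x_0=0$, with i.i.d. noise $w_t\sim\mathcal N(0,I)$ for every $t\ge 0$. Then for any matrix $A\in\mathbb R^{n_x\times n_x}$, all $\varepsilon>0$ and all $\delta\in(0,1)$, the sample complexity $\tau_A$ of any $(\varepsilon,\delta)$-locally stable algorithm in $A$ with centered excitation satisfies $$\lambda_{\min}\!\left(\sum_{s=1}^{\tau_A-1}\Sigma_s\right)\ \ge\ \frac{1}{2\varepsilon^2}\log\!\left(\frac{1}{3\delta}\right),$$ where $\Sigma_s:=\mathbb E[x_sx_s^\top]$. Moreover, for any $s\ge 0$, $$\Sigma_{s+1}=A\Sigma_sA^\top+BU_sB^\top+I,\qquad U_s:=\mathbb E[u_su_s^\top].$$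
   Context: Setting: $x_t\in\mathbb R^{n_x}$, $u_t\in\mathbb R^{n_u}$, $B\in\mathbb R^{n_x\times n_u}$ is known and $A$ is unknown. $\{w_t\}_{t\ge0}$ is i.i.d., and $w_t$ is independent of $(x_0,\dots,x_t,u_0,\dots,u_t)$. $\mathcal F_t$ is the $\sigma$-algebra generated by $\{x_0,\dots,x_t,u_0,\dots,u_{t-1}\}$ (a single trajectory, no state resets). Algorithm: it consists of (i) a control policy $\{\pi_t\}$ of conditional densities (with respect to Lebesgue measure, not depending on the unknown $A$) such that for any Borel set $\mathbb U\subseteq\mathbb R^{n_u}$, almost surely $\mathbb P(u_t\in\mathbb U\mid\mathcal F_t)=\int_{\mathbb U}\pi_t(u\mid x_1,\dots,x_t,u_0,\dots,u_{t-1})\,du$; and (ii) for each $t$, an $\mathcal F_t$-measurable estimate $\widehat A_t\in\mathbb R^{n_x\times n_x}$ of $A$. $\mathbb P_{A'}$ denotes the law of the trajectory when the system matrix is $A'$ (same algorithm, same $B$, same noise law); $\mathbb P,\mathbb E$ without subscript are under the matrix $A$. Locally stable: the algorithm is $(\varepsilon,\delta)$-locally stable in $A$ if there is a finite deterministic time $\tau$ such that for any $t\ge\tau$, $$\inf_{A'\in\mathcal B(A,6\sqrt2\varepsilon)}\mathbb P_{A'}\big(\|\widehat A_t-A'\|\le\varepsilon\big)\ge 1-\delta,\qquad \mathcal B(A,6\sqrt2\varepsilon):=\{A'\in\mathbb R^{n_x\times n_x}:\|A-A'\|\le 6\sqrt2\,\varepsilon\}.$$ Its sample complexity $\tau_A$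 is the minimal $\tau$ for which this inequality holds for all $t\ge\tau$. Centered excitation: $\mathbb E[u_t\mid\mathcal F_t]=0$ and $\mathbb E[\|u_t\|^2]<\infty$ for any $t\ge0$. $\|\cdot\|$ is the spectral norm for matrices and the Euclidean norm for vectors; $\lambda_{\min}$ is the minimum eigenvalue; an empty sum is $0$. *)

theory Defs
  imports "HOL-Probability.Probability"
begin

text \<open>The norm of the type \<open>real ^ 'n ^ 'm\<close> is the Frobenius norm, so the spectral norm
  has to be taken as the operator norm of the associated linear map.\<close>

definition spectral_norm :: "real ^ 'n ^ 'm \<Rightarrow> real"
  where "spectral_norm M = onorm (\<lambda>v. M *v v)"

definition eigenvalues :: "real ^ 'n ^ 'n \<Rightarrow> real set"
  where "eigenvalues M = {c. \<exists>v. v \<noteq> 0 \<and> M *v v = c *\<^sub>R v}"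

definition lambda_min :: "real ^ 'n ^ 'n \<Rightarrow> real"
  where "lambda_min M = Min (eigenvalues M)"

definition outer :: "real ^ 'n \<Rightarrow> real ^ 'm \<Rightarrow> real ^ 'm ^ 'n"
  where "outer v w = (\<chi> i j. v $ i * w $ j)"

text \<open>\<open>second_moment M z\<close> is the matrix-valued expectation of \<open>z z\<^sup>T\<close> under \<open>M\<close>.\<close>

definition second_moment :: "'a measure \<Rightarrow> ('a \<Rightarrow> real ^ 'n) \<Rightarrow> real ^ 'n ^ 'n"
  where "second_moment M z = (\<integral>\<omega>. outer (z \<omega>) (z \<omega>) \<partial>M)"

text \<open>Lebesgue density of the Gaussian law with mean zero and identity covariance.\<close>

definition std_gaussian_density :: "real ^ 'n \<Rightarrow> real"
  where "std_gaussian_density v = exp (- (norm v)\<^sup>2 / 2) / sqrt (2 * pi) ^ CARD('n)"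

text \<open>The \<open>\<sigma>\<close>-algebra generated by the states at times \<open>I\<close> and the inputs at times \<open>J\<close>.\<close>

definition traj_algebra ::
  "'a measure \<Rightarrow> (nat \<Rightarrow> 'a \<Rightarrow> real ^ 'n) \<Rightarrow> nat set \<Rightarrow> (nat \<Rightarrow> 'a \<Rightarrow> real ^ 'm) \<Rightarrow> nat set \<Rightarrow> 'a measure"
  where "traj_algebra \<Omega> x I u J = sigma (space \<Omega>)
    ({x i -` S \<inter> space \<Omega> | i S. i \<in> I \<and> S \<in> sets borel} \<union>
     {u j -` S \<inter> space \<Omega> | j S. j \<in> J \<and> S \<in> sets borel})"

abbreviation past_algebra ::
  "'a measure \<Rightarrow> (nat \<Rightarrow> 'a \<Rightarrow> real ^ 'n) \<Rightarrow> (nat \<Rightarrow> 'a \<Rightarrow> real ^ 'm) \<Rightarrow> nat \<Rightarrow> 'a measure"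
  where "past_algebra \<Omega> x u t \<equiv> traj_algebra \<Omega> x {..t} u {..<t}"

text \<open>The policy at time \<open>t\<close> maps the observed past \<open>(x\<^sub>1, \<dots>, x\<^sub>t)\<close>, \<open>(u\<^sub>0, \<dots>, u\<^sub>t\<^sub>-\<^sub>1)\<close>,
  an element of the following product space, to a probability density on the input space.\<close>

type_synonym ('n, 'm) past = "(nat \<Rightarrow> real ^ 'n) \<times> (nat \<Rightarrow> real ^ 'm)"

definition past_space :: "nat \<Rightarrow> ('n::finite, 'm::finite) past measure"
  where "past_space t = (\<Pi>\<^sub>M i\<in>{1..t}. borel) \<Otimes>\<^sub>M (\<Pi>\<^sub>M i\<in>{..<t}. borel)"

definition past ::
  "(nat \<Rightarrow> 'a \<Rightarrow> real ^ 'n) \<Rightarrow> (nat \<Rightarrow> 'a \<Rightarrow> real ^ 'm) \<Rightarrow> nat \<Rightarrow> 'a \<Rightarrow> ('n::finite, 'm::finite) past"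
  where "past x u t \<omega> = (\<lambda>i\<in>{1..t}. x i \<omega>, \<lambda>i\<in>{..<t}. u i \<omega>)"

definition control_policy ::
  "(nat \<Rightarrow> ('n::finite, 'm::finite) past \<Rightarrow> real ^ 'm \<Rightarrow> real) \<Rightarrow> bool"
  where "control_policy \<pi> \<longleftrightarrow> (\<forall>t.
    (\<lambda>(h, v). \<pi> t h v) \<in> borel_measurable (past_space t \<Otimes>\<^sub>M borel) \<and>
    (\<forall>h\<in>space (past_space t).
      (\<forall>v. 0 \<le> \<pi> t h v) \<and> prob_space (density lborel (\<lambda>v. ennreal (\<pi> t h v)))))"

definition algorithm ::
  "'a measure \<Rightarrow> (nat \<Rightarrow> 'a \<Rightarrow> real ^ 'n) \<Rightarrow> (nat \<Rightarrow> 'a \<Rightarrow> real ^ 'm) \<Rightarrow>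
   (nat \<Rightarrow> ('n::finite, 'm::finite) past \<Rightarrow> real ^ 'm \<Rightarrow> real) \<Rightarrow>
   (nat \<Rightarrow> 'a \<Rightarrow> real ^ 'n ^ 'n) \<Rightarrow> bool"
  where "algorithm \<Omega> x u \<pi> Ahat \<longleftrightarrow>
    control_policy \<pi> \<and>
    (\<forall>t. Ahat t \<in> borel_measurable (past_algebra \<Omega> x u t))"

text \<open>The trajectory \<open>(x, u)\<close> lives on a fixed measurable space \<open>\<Omega>\<close> (for instance the
  canonical space of trajectories), and only the probability measure on \<open>\<Omega>\<close> changes with the
  system matrix. The predicate says that under \<open>P\<close> the trajectory is generated by the system
  with matrices \<open>A\<close>, \<open>B\<close>, zero initial state and standard Gaussian noise \<open>w\<close>, in closed loop
  with the policy \<open>\<pi>\<close>. For fixed \<open>x\<close> and \<open>u\<close> the noise is the residual of the dynamics; it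
  therefore depends on the system matrix.\<close>

definition closed_loop ::
  "'a measure \<Rightarrow> (nat \<Rightarrow> 'a \<Rightarrow> real ^ 'n) \<Rightarrow> (nat \<Rightarrow> 'a \<Rightarrow> real ^ 'm) \<Rightarrow>
   (nat \<Rightarrow> ('n::finite, 'm::finite) past \<Rightarrow> real ^ 'm \<Rightarrow> real) \<Rightarrow>
   real ^ 'n ^ 'n \<Rightarrow> real ^ 'm ^ 'n \<Rightarrow> (nat \<Rightarrow> 'a \<Rightarrow> real ^ 'n) \<Rightarrow> 'a measure \<Rightarrow> bool"
  where "closed_loop \<Omega> x u \<pi> A B w P \<longleftrightarrow>
    prob_space P \<and> sets P = sets \<Omega> \<and>
    (\<forall>t. x t \<in> borel_measurable \<Omega> \<and> u t \<in> borel_measurable \<Omega>) \<and>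
    (AE \<omega> in P. x 0 \<omega> = 0) \<and>
    (\<forall>t. AE \<omega> in P. x (t + 1) \<omega> = A *v x t \<omega> + B *v u t \<omega> + w t \<omega>) \<and>
    prob_space.indep_vars P (\<lambda>_. borel) w UNIV \<and>
    (\<forall>t. distributed P lborel (w t) (\<lambda>v. ennreal (std_gaussian_density v))) \<and>
    (\<forall>t. prob_space.indep_set P
       (sets (vimage_algebra (space \<Omega>) (w t) borel))
       (sets (traj_algebra \<Omega> x {..t} u {..t}))) \<and>
    (\<forall>t. \<forall>U\<in>sets borel. AE \<omega> in P.
       real_cond_exp P (past_algebra \<Omega> x u t) (indicator {\<omega> \<in> space \<Omega>. u t \<omega> \<in> U}) \<omega>
       = (LINT v:U|lborel. \<pi> t (past x u t \<omega>) v))"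

text \<open>\<open>P A'\<close> is the law under the system matrix \<open>A'\<close>.\<close>

definition stable_from ::
  "(real ^ 'n ^ 'n \<Rightarrow> 'a measure) \<Rightarrow> (nat \<Rightarrow> 'a \<Rightarrow> real ^ 'n ^ 'n) \<Rightarrow>
   real \<Rightarrow> real \<Rightarrow> real ^ 'n ^ 'n \<Rightarrow> nat \<Rightarrow> bool"
  where "stable_from P Ahat \<epsilon> \<delta> A \<tau> \<longleftrightarrow> (\<forall>t\<ge>\<tau>.
    (INF A'\<in>{A'. spectral_norm (A - A') \<le> 6 * sqrt 2 * \<epsilon>}.
       measure (P A') {\<omega> \<in> space (P A'). spectral_norm (Ahat t \<omega> - A') \<le> \<epsilon>}) \<ge> 1 - \<delta>)"

definition locally_stable ::
  "(real ^ 'n ^ 'n \<Rightarrow> 'a measure) \<Rightarrow> (nat \<Rightarrow> 'a \<Rightarrow> real ^ 'n ^ 'n) \<Rightarrow>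
   real \<Rightarrow> real \<Rightarrow> real ^ 'n ^ 'n \<Rightarrow> bool"
  where "locally_stable P Ahat \<epsilon> \<delta> A \<longleftrightarrow> (\<exists>\<tau>. stable_from P Ahat \<epsilon> \<delta> A \<tau>)"

definition sample_complexity ::
  "(real ^ 'n ^ 'n \<Rightarrow> 'a measure) \<Rightarrow> (nat \<Rightarrow> 'a \<Rightarrow> real ^ 'n ^ 'n) \<Rightarrow>
   real \<Rightarrow> real \<Rightarrow> real ^ 'n ^ 'n \<Rightarrow> nat"
  where "sample_complexity P Ahat \<epsilon> \<delta> A = (LEAST \<tau>. stable_from P Ahat \<epsilon> \<delta> A \<tau>)"

text \<open>The conditional expectation of a vector is taken componentwise.\<close>

definition centered_excitation ::
  "'a measure \<Rightarrow> (nat \<Rightarrow> 'a \<Rightarrow> real ^ 'n) \<Rightarrow> (nat \<Rightarrow> 'a \<Rightarrow> real ^ 'm) \<Rightarrow> 'a measure \<Rightarrow> bool"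
  where "centered_excitation \<Omega> x u P \<longleftrightarrow> (\<forall>t.
    (\<forall>i. AE \<omega> in P. real_cond_exp P (past_algebra \<Omega> x u t) (\<lambda>\<omega>. u t \<omega> $ i) \<omega> = 0) \<and>
    integrable P (\<lambda>\<omega>. (norm (u t \<omega>))\<^sup>2))"

end

theory Submission
  imports Defs
begin

text \<open>Between the matrices \<open>A\<close> and \<open>A + D\<close> the policy contributes nothing to the likelihood ratio
  of a trajectory, so its logarithm is a sum of Gaussian terms, whose expectation under \<open>A\<close> after
  \<open>\<tau>\<close> steps is \<open>- 1/2 \<Sum>\<^sub>s E \<parallel>D x\<^sub>s\<parallel>\<^sup>2\<close>. If \<open>\<parallel>D\<parallel> > 2 \<epsilon>\<close>, the event that the estimate is
  \<open>\<epsilon>\<close>-close to \<open>A\<close> has probability at least \<open>1 - \<delta>\<close> under \<open>A\<close> and at most \<open>\<delta>\<close> under \<open>A + D\<close>, and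
  the data processing inequality bounds the energy from below. The theorem follows for
  \<open>D = c v v\<^sup>T\<close>, where \<open>v\<close> is a unit eigenvector for the minimal eigenvalue and \<open>c\<close> tends to \<open>2 \<epsilon>\<close>.\<close>

section \<open>Minimal eigenvalues and the spectral norm\<close>

text \<open>The law of an input is known only through its conditional probabilities given the past,
  so no joint density of the trajectory is written down. The two laws are compared on a growing
  chain of sigma-algebras instead: adjoining an input keeps the ratio, because both laws use the
  same kernel, and adjoining a state multiplies it by a quotient of Gaussian densities. The last
  factor, from adjoining \<open>x \<tau>\<close>, involves the state one step earlier; together with
  \<open>x 0 = 0\<close> this gives the range of the sum.

  The closed balls of radius \<epsilon> about \<open>A\<close> and \<open>A + D\<close> can touch if
  \<open>D\<close> has norm exactly \<open>2 * \<epsilon>\<close>. The two events are disjoint only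
  beyond that, hence the limit in \<open>c\<close>, taken inside the ball of radius
  \<open>6 * sqrt 2 * \<epsilon>\<close>. At \<open>c = 2 * \<epsilon>\<close> half the energy is
  \<open>2 * \<epsilon>\<^sup>2\<close> times the minimal eigenvalue, the factor in the bound. The
  term \<open>ln (1 / (3 * \<delta>))\<close> is an elementary lower bound for a binary relative
  entropy when \<open>\<delta> < 1 / 3\<close>; otherwise it is nonpositive and the claim reduces to
  the positivity of second moments.\<close>

lemma symmetric_matrix_inner:
  fixes S :: "real ^ 'n ^ 'n"
  assumes "transpose S = S"
  shows "(S *v a) \<bullet> b = a \<bullet> (S *v b)"
  by (metis assms dot_lmul_matrix vector_transpose_matrix inner_commute)

text \<open>\<open>lambda_min\<close> is a \<open>Min\<close>, which is meaningful only on a finite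
  set. Eigenvectors for distinct eigenvalues are orthogonal and a pairwise orthogonal set is finite,
  so choosing one eigenvector per eigenvalue bounds their number.\<close>

lemma finite_eigenvalues_symmetric:
  fixes S :: "real ^ 'n ^ 'n"
  assumes "transpose S = S"
  shows "finite (eigenvalues S)"
proof -
  have "\<forall>c\<in>eigenvalues S. \<exists>v. v \<noteq> 0 \<and> S *v v = c *\<^sub>R v"
    by (auto simp: eigenvalues_def)
  then obtain e where e: "\<And>c. c \<in> eigenvalues S \<Longrightarrow> e c \<noteq> 0 \<and> S *v e c = c *\<^sub>R e c"
    by metis
  have ortho: "e a \<bullet> e b = 0" if "a \<in> eigenvalues S" "b \<in> eigenvalues S" "a \<noteq> b" for a b
  proof -
    have "a * (e a \<bullet> e b) = b * (e a \<bullet> e b)"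
      using symmetric_matrix_inner[OF assms, of "e a" "e b"] e that by simp
    with that show ?thesis by simp
  qed
  have "inj_on e (eigenvalues S)"
    using ortho e by (metis inj_onI inner_eq_zero_iff)
  moreover have "pairwise orthogonal (e ` eigenvalues S)"
    using ortho by (auto simp: pairwise_def orthogonal_def)
  then have "finite (e ` eigenvalues S)"
    using pairwise_orthogonal_imp_finite by blast
  ultimately show ?thesis
    using finite_image_iff by blast
qed

text \<open>For small \<open>r\<close> a positive linear term would dominate the quadratic one. This
  is the first-order condition behind the variational argument below; \<open>r = a / K\<close> is
  small enough as soon as \<open>K\<close> is positive and exceeds \<open>b\<close>.\<close>

lemma quadratic_bound_imp_nonpos:
  fixes a b :: real
  assumes "\<And>r. 2 * r * a \<le> r\<^sup>2 * b"
  shows "a \<le> 0"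
proof (rule ccontr)
  assume "\<not> a \<le> 0"
  define K where "K = \<bar>b\<bar> + 1"
  have K: "b < K" "0 < K" by (auto simp: K_def)
  have "2 * (a / K) * a \<le> (a / K)\<^sup>2 * b" by (rule assms)
  then have "(2 * K) * a\<^sup>2 \<le> b * a\<^sup>2"
    using K(2) by (simp add: field_simps power2_eq_square)
  then have "2 * K \<le> b"
    using \<open>\<not> a \<le> 0\<close> by simp
  with K show False by linarith
qed

text \<open>The quadratic form attains a minimum \<mu> on the compact unit sphere. Then
  \<open>S\<close> minus \<mu> times the identity is positive semidefinite with a form vanishing at
  the minimiser, which therefore lies in its kernel. Evaluating the form at any other eigenvector
  shows that no eigenvalue is smaller.\<close>

lemma minimal_eigenvector_symmetric:
  fixes S :: "real ^ 'n ^ 'n"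
  assumes sym: "transpose S = S"
  obtains v where "norm v = 1" and "S *v v = lambda_min S *\<^sub>R v"
proof -
  let ?q = "\<lambda>y. y \<bullet> (S *v y)"
  have cont: "continuous_on (sphere 0 1) ?q"
    by (intro continuous_intros matrix_vector_mult_linear_continuous_on)
  obtain v where v: "norm v = 1" and min: "\<And>y. norm y = 1 \<Longrightarrow> ?q v \<le> ?q y"
  proof -
    have "sphere (0 :: real ^ 'n) 1 \<noteq> {}" by simp
    from continuous_attains_inf[OF compact_sphere this cont] show thesis
      by (auto intro: that)
  qed
  define \<mu> where "\<mu> = ?q v"
  have ge: "\<mu> * (y \<bullet> y) \<le> ?q y" for y
  proof (cases "y = 0")
    case False
    have "\<mu> \<le> ?q (y /\<^sub>R norm y)"
      unfolding \<mu>_def using False by (intro min) simp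
    also have "\<dots> = ?q y / (norm y)\<^sup>2"
      by (simp add: matrix_vector_mult_scaleR power2_eq_square divide_inverse)
    finally show ?thesis
      using False by (simp add: field_simps dot_square_norm)
  qed simp
  let ?T = "\<lambda>y. S *v y - \<mu> *\<^sub>R y"
  have T0: "v \<bullet> ?T v = 0"
    using v by (simp add: \<mu>_def inner_diff_right dot_square_norm)
  have "?T v = 0"
  proof (rule ccontr)
    assume nz: "?T v \<noteq> 0"
    define g where "g = ?T v"
    have T_sym: "a \<bullet> ?T b = ?T a \<bullet> b" for a b
      by (simp add: inner_diff_right inner_diff_left symmetric_matrix_inner[OF sym])
    have Tv: "v \<bullet> ?T g = g \<bullet> g" "g \<bullet> ?T v = g \<bullet> g"
      using T_sym[of v g] by (simp_all add: g_def)
    \<comment> \<open>Moving from \<open>v\<close> against \<open>g\<close> changes the form by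
      \<open>- 2 * r * (g \<bullet> g)\<close> at first order, and semidefiniteness forbids a
      negative value.\<close>
    have "2 * r * (g \<bullet> g) \<le> r\<^sup>2 * (g \<bullet> ?T g)" for r
    proof -
      have T_lin: "?T (v - r *\<^sub>R g) = ?T v - r *\<^sub>R ?T g"
        by (simp add: matrix_vector_mult_diff_distrib matrix_vector_mult_scaleR algebra_simps)
      have "0 \<le> (v - r *\<^sub>R g) \<bullet> ?T (v - r *\<^sub>R g)"
        using ge[of "v - r *\<^sub>R g"] by (simp add: inner_diff_right)
      also have "\<dots> = v \<bullet> ?T v - r * (g \<bullet> ?T v) - r * (v \<bullet> ?T g - r * (g \<bullet> ?T g))"
        unfolding T_lin by (simp only: inner_diff_right[of _ "?T v"] inner_diff_left[of v "r *\<^sub>R g"]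
            inner_scaleR_left inner_scaleR_right)
      finally show ?thesis
        unfolding T0 Tv by (simp add: algebra_simps power2_eq_square)
    qed
    from quadratic_bound_imp_nonpos[OF this] show False
      using nz inner_gt_zero_iff[of g] by (simp add: g_def del: inner_gt_zero_iff)
  qed
  then have eig: "S *v v = \<mu> *\<^sub>R v" by simp
  have "v \<noteq> 0" using v by auto
  then have "\<mu> \<in> eigenvalues S" using eig by (auto simp: eigenvalues_def)
  moreover have "\<mu> \<le> c" if "c \<in> eigenvalues S" for c
  proof -
    obtain y where "y \<noteq> 0" "S *v y = c *\<^sub>R y" using \<open>c \<in> eigenvalues S\<close> by (auto simp: eigenvalues_def)
    then show ?thesis using ge[of y] by simp
  qed
  ultimately have "lambda_min S = \<mu>"
    unfolding lambda_min_def using finite_eigenvalues_symmetric[OF sym] by (intro Min_eqI) auto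
  with v eig that show thesis by simp
qed

section \<open>Operator norm estimates and measurability\<close>

lemma bounded_linear_matrix_vector: "bounded_linear (\<lambda>v. (M :: real ^ 'n ^ 'm) *v v)"
  by (simp add: linear_conv_bounded_linear[symmetric])

lemma spectral_norm_triangle:
  "spectral_norm (M + N) \<le> spectral_norm M + spectral_norm N" for M N :: "real ^ 'n ^ 'm"
  unfolding spectral_norm_def matrix_vector_mult_add_rdistrib
  by (intro onorm_triangle bounded_linear_matrix_vector)

lemma spectral_norm_minus: "spectral_norm (- M) = spectral_norm M" for M :: "real ^ 'n ^ 'm"
proof -
  have "(\<lambda>v. - M *v v) = (\<lambda>v. - (M *v v))"
    by (simp add: fun_eq_iff vec_eq_iff matrix_vector_mult_def sum_negf)
  then show ?thesis by (simp add: spectral_norm_def onorm_neg)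
qed

text \<open>The factor is crude, but any multiple of the Frobenius norm makes the spectral norm
  Lipschitz for the topology of the type, hence Borel measurable; this is what makes the estimation
  events measurable.\<close>

lemma spectral_norm_le_norm:
  fixes M :: "real ^ 'n ^ 'm"
  shows "spectral_norm M \<le> real CARD('m) * real CARD('n) * norm M"
  unfolding spectral_norm_def
proof (rule onorm_le_matrix_component)
  show "\<bar>M $ i $ j\<bar> \<le> norm M" for i j
    using component_le_norm_cart[of "M $ i" j] Finite_Cartesian_Product.norm_nth_le[of M i] by linarith
qed

lemma continuous_on_spectral_norm:
  "continuous_on UNIV (spectral_norm :: real ^ 'n ^ 'm \<Rightarrow> real)"
proof (rule lipschitz_on_continuous_on[where L="real CARD('m) * real CARD('n)"], rule lipschitz_onI)
  fix M N :: "real ^ 'n ^ 'm"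
  have "spectral_norm M \<le> spectral_norm N + spectral_norm (M - N)"
    and "spectral_norm N \<le> spectral_norm M + spectral_norm (M - N)"
    using spectral_norm_triangle[of N "M - N"] spectral_norm_triangle[of M "N - M"]
      spectral_norm_minus[of "M - N"] by auto
  then show "dist (spectral_norm M) (spectral_norm N) \<le> real CARD('m) * real CARD('n) * dist M N"
    using spectral_norm_le_norm[of "M - N"] by (simp add: dist_norm)
qed simp

lemma borel_measurable_spectral_norm [measurable]:
  "(spectral_norm :: real ^ 'n ^ 'm \<Rightarrow> real) \<in> borel_measurable borel"
  by (rule borel_measurable_continuous_onI[OF continuous_on_spectral_norm])

lemma outer_matrix_vector: "outer v a *v y = (a \<bullet> y) *\<^sub>R v"
  by (simp add: vec_eq_iff outer_def matrix_vector_mult_def inner_vec_def sum_distrib_left mult_ac)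

text \<open>This is the perturbation used in the end: \<open>c\<close> tunes its size, while its
  action on a state sees only the component along \<open>v\<close>. Cauchy-Schwarz bounds the norm
  from above and \<open>v\<close> itself attains the bound.\<close>

lemma spectral_norm_scaled_projection:
  fixes v :: "real ^ 'n"
  assumes "norm v = 1" and "0 \<le> c"
  shows "spectral_norm (c *\<^sub>R outer v v) = c"
proof (rule antisym)
  have eq: "(c *\<^sub>R outer v v) *v y = (c * (v \<bullet> y)) *\<^sub>R v" for y
    by (simp add: scaleR_matrix_vector_assoc[symmetric] outer_matrix_vector)
  show "spectral_norm (c *\<^sub>R outer v v) \<le> c"
    unfolding spectral_norm_def
  proof (rule onorm_le)
    show "norm ((c *\<^sub>R outer v v) *v y) \<le> c * norm y" for y
      using assms Cauchy_Schwarz_ineq2[of v y] unfolding eq by (simp add: abs_mult mult_left_mono)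
  qed
  show "c \<le> spectral_norm (c *\<^sub>R outer v v)"
    using onorm[OF bounded_linear_matrix_vector, of "c *\<^sub>R outer v v" v] assms
    unfolding eq spectral_norm_def by (simp add: dot_square_norm)
qed

section \<open>Gaussian integrals\<close>

lemma std_gaussian_density_nonneg: "0 \<le> std_gaussian_density v"
  by (simp add: std_gaussian_density_def)

lemma borel_measurable_std_gaussian_density [measurable]:
  "std_gaussian_density \<in> borel_measurable borel"
  unfolding std_gaussian_density_def[abs_def] by measurable

lemma std_gaussian_density_eq_prod:
  fixes v :: "real ^ 'n"
  shows "std_gaussian_density v = (\<Prod>i\<in>UNIV. std_normal_density (v $ i))"
proof -
  have "(norm v)\<^sup>2 = (\<Sum>i\<in>UNIV. (v $ i)\<^sup>2)"
    by (simp add: norm_vec_def L2_set_def sum_nonneg)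
  then show ?thesis
    by (simp add: std_gaussian_density_def std_normal_density_def prod.distrib power_one_over
        exp_sum[symmetric] sum_divide_distrib[symmetric] sum_negf prod_dividef divide_simps)
qed

text \<open>The quotient of the Gaussian densities with means \<open>a\<close> and 0 is the
  exponential of an affine function of \<open>v\<close>. The increments of the log-likelihood have
  this shape with \<open>a = D *v x t\<close>.\<close>

lemma std_gaussian_density_shift:
  "std_gaussian_density (v - a) = std_gaussian_density v * exp (v \<bullet> a - (norm a)\<^sup>2 / 2)"
proof -
  have "- (norm (v - a))\<^sup>2 / 2 = - (norm v)\<^sup>2 / 2 + (v \<bullet> a - (norm a)\<^sup>2 / 2)"
    by (simp add: dot_square_norm[symmetric] inner_diff_left inner_diff_right inner_commute field_simps)
  then show ?thesis
    unfolding std_gaussian_density_def by (simp only: exp_add times_divide_eq_left)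
qed

text \<open>Fubini: Lebesgue measure is the image of a product measure indexed by
  \<open>Basis\<close>, so Gaussian integrals reduce to one-dimensional moments. The map
  \<open>?idx\<close> leads from a basis vector back to its coordinate.\<close>

lemma has_bochner_integral_lborel_vec_prod:
  fixes f :: "'n::finite \<Rightarrow> real \<Rightarrow> real"
  assumes "\<And>i. has_bochner_integral lborel (f i) (I i)"
  shows "has_bochner_integral lborel (\<lambda>v :: real ^ 'n. \<Prod>i\<in>UNIV. f i (v $ i)) (\<Prod>i\<in>UNIV. I i)"
proof -
  interpret product_sigma_finite "\<lambda>_ :: real ^ 'n. lborel :: real measure" ..
  let ?idx = "\<lambda>b :: real ^ 'n. THE i. b = axis i 1"
  have idx [simp]: "?idx (axis i 1) = i" for i :: 'n
    by (auto simp: axis_eq_axis)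
  have bij: "bij_betw (\<lambda>i :: 'n. axis i (1 :: real)) UNIV Basis"
    by (auto simp: bij_betw_def inj_on_def axis_eq_axis Basis_vec_def)
  have [measurable]: "f i \<in> borel_measurable borel" for i
    using assms[of i] by (auto dest: borel_measurable_has_bochner_integral)
  have eq: "(\<Prod>i\<in>UNIV. f i (\<Sum>b\<in>Basis. g b * b $ i)) = (\<Prod>b\<in>Basis. f (?idx b) (g b))"
    for g :: "real ^ 'n \<Rightarrow> real"
  proof -
    have "(\<Sum>b\<in>Basis. g b * b $ i) = g (axis i 1)" for i
    proof -
      have "(\<Sum>b\<in>Basis. g b * b $ i) = (\<Sum>b\<in>Basis. g b *\<^sub>R b) \<bullet> axis i 1"
        by (simp add: inner_axis)
      also have "\<dots> = g (axis i 1)"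
        by (subst inner_sum_left_Basis) (auto simp: Basis_vec_def)
      finally show ?thesis .
    qed
    then show ?thesis
      by (simp add: prod.reindex_bij_betw[OF bij, symmetric])
  qed
  have int: "integrable lborel (f i)" and I: "integral\<^sup>L lborel (f i) = I i" for i
    using assms[of i] by (auto simp: has_bochner_integral_iff)
  have "(\<Prod>b\<in>Basis. integral\<^sup>L lborel (f (?idx b))) = (\<Prod>i\<in>UNIV. I i)"
    by (subst prod.reindex_bij_betw[OF bij, symmetric]) (simp add: I)
  moreover have "(\<lambda>g. \<Sum>b\<in>Basis. g b *\<^sub>R b) \<in> (\<Pi>\<^sub>M b\<in>(Basis :: (real ^ 'n) set). lborel) \<rightarrow>\<^sub>M borel"
    by measurable
  moreover have "integrable (\<Pi>\<^sub>M b\<in>(Basis :: (real ^ 'n) set). lborel) (\<lambda>g. \<Prod>b\<in>Basis. f (?idx b) (g b))"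
    by (rule product_integrable_prod) (simp_all add: int)
  moreover have "(\<integral>g. (\<Prod>b\<in>Basis. f (?idx b) (g b)) \<partial>(\<Pi>\<^sub>M b\<in>(Basis :: (real ^ 'n) set). lborel))
      = (\<Prod>b\<in>Basis. integral\<^sup>L lborel (f (?idx b)))"
    by (rule product_integral_prod) (simp_all add: int)
  ultimately show ?thesis
    unfolding has_bochner_integral_iff
    by (subst (1 2) lborel_eq) (simp add: integrable_distr_eq integral_distr eq)
qed

lemma std_gaussian_moments:
  fixes i j :: "'n::finite"
  shows "has_bochner_integral lborel (\<lambda>v :: real ^ 'n. std_gaussian_density v * v $ i) 0"
    and "has_bochner_integral lborel (\<lambda>v :: real ^ 'n. std_gaussian_density v * (v $ i * v $ j))
      (if i = j then 1 else 0)"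
proof -
  have m0: "has_bochner_integral lborel std_normal_density 1"
    using std_normal_moment_even[of 0] by simp
  have m1: "has_bochner_integral lborel (\<lambda>y. std_normal_density y * y) 0"
    using std_normal_moment_odd[of 0] by simp
  have m2: "has_bochner_integral lborel (\<lambda>y. std_normal_density y * (y * y)) 1"
    using std_normal_moment_even[of 1] by (simp add: power2_eq_square)
  let ?f1 = "\<lambda>k y. std_normal_density y * (if k = i then y else 1)"
  have "has_bochner_integral lborel (\<lambda>v :: real ^ 'n. \<Prod>k\<in>UNIV. ?f1 k (v $ k))
      (\<Prod>k\<in>UNIV. if k = i then 0 else 1)"
    using m0 m1 by (intro has_bochner_integral_lborel_vec_prod) auto
  moreover have "(\<Prod>k\<in>UNIV. if k = i then 0 else 1 :: real) = 0"
    by (rule prod_zero) auto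
  ultimately show "has_bochner_integral lborel (\<lambda>v :: real ^ 'n. std_gaussian_density v * v $ i) 0"
    by (simp add: std_gaussian_density_eq_prod prod.distrib)
  \<comment> \<open>A coordinate contributes its second moment 1 if it equals both indices, its mass
    1 if it equals neither, and its mean 0 if it equals exactly one; hence the test
    \<open>(k = i) = (k = j)\<close>.\<close>
  let ?f2 = "\<lambda>k y. std_normal_density y * ((if k = i then y else 1) * (if k = j then y else 1))"
  have "has_bochner_integral lborel (\<lambda>v :: real ^ 'n. \<Prod>k\<in>UNIV. ?f2 k (v $ k))
      (\<Prod>k\<in>UNIV. if (k = i) = (k = j) then 1 else 0)"
    using m0 m1 m2 by (intro has_bochner_integral_lborel_vec_prod) auto
  moreover have "(\<Prod>k\<in>UNIV. if (k = i) = (k = j) then 1 else 0) = (if i = j then 1 else 0 :: real)"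
    by (auto intro!: prod_zero)
  ultimately show "has_bochner_integral lborel (\<lambda>v :: real ^ 'n. std_gaussian_density v * (v $ i * v $ j))
      (if i = j then 1 else 0)"
    by (simp add: std_gaussian_density_eq_prod prod.distrib)
qed

section \<open>Trajectory algebras\<close>

lemma space_traj_algebra [simp]: "space (traj_algebra \<Omega> x I u J) = space \<Omega>"
  by (simp add: traj_algebra_def space_measure_of_conv)

lemma sets_traj_algebra:
  "sets (traj_algebra \<Omega> x I u J) = sigma_sets (space \<Omega>)
    ({x i -` S \<inter> space \<Omega> | i S. i \<in> I \<and> S \<in> sets borel} \<union>
     {u j -` S \<inter> space \<Omega> | j S. j \<in> J \<and> S \<in> sets borel})"
  unfolding traj_algebra_def by (subst sets_measure_of) auto

lemma measurable_traj_algebra_state: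
  "i \<in> I \<Longrightarrow> x i \<in> borel_measurable (traj_algebra \<Omega> x I u J)"
  by (rule measurableI) (auto simp: sets_traj_algebra intro!: sigma_sets.Basic)

lemma measurable_traj_algebra_input:
  "j \<in> J \<Longrightarrow> u j \<in> borel_measurable (traj_algebra \<Omega> x I u J)"
  by (rule measurableI) (auto simp: sets_traj_algebra intro!: sigma_sets.Basic)

lemma sets_traj_algebra_le:
  assumes "space N = space \<Omega>"
    and "\<And>i. i \<in> I \<Longrightarrow> x i \<in> borel_measurable N"
    and "\<And>j. j \<in> J \<Longrightarrow> u j \<in> borel_measurable N"
  shows "sets (traj_algebra \<Omega> x I u J) \<subseteq> sets N"
  unfolding sets_traj_algebra assms(1)[symmetric]
  by (rule sets.sigma_sets_subset) (auto intro: measurable_sets assms)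

lemma sets_traj_algebra_mono:
  assumes "I \<subseteq> I'" and "J \<subseteq> J'"
  shows "sets (traj_algebra \<Omega> x I u J) \<subseteq> sets (traj_algebra \<Omega> x I' u J')"
  using assms
  by (intro sets_traj_algebra_le measurable_traj_algebra_state measurable_traj_algebra_input) auto

lemma measurable_traj_algebra_mono:
  assumes "f \<in> measurable (traj_algebra \<Omega> x I u J) N" and "I \<subseteq> I'" and "J \<subseteq> J'"
  shows "f \<in> measurable (traj_algebra \<Omega> x I' u J') N"
  by (rule subsetD[OF measurable_mono assms(1)]) (use assms sets_traj_algebra_mono in simp_all)

text \<open>The join of \<open>N\<close> with the sigma-algebra of \<open>X\<close>. Intersections
  serve as generators, rather than the union of the two families, because they are stable under
  intersection and so determine finite measures.\<close>

definition adjoin :: "'a measure \<Rightarrow> ('a \<Rightarrow> 'b :: topological_space) \<Rightarrow> 'a measure"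
  where "adjoin N X = sigma (space N) {F \<inter> X -` U | F U. F \<in> sets N \<and> U \<in> sets borel}"

lemma space_adjoin [simp]: "space (adjoin N X) = space N"
  by (simp add: adjoin_def space_measure_of_conv)

lemma sets_adjoin:
  "sets (adjoin N X) = sigma_sets (space N) {F \<inter> X -` U | F U. F \<in> sets N \<and> U \<in> sets borel}"
  unfolding adjoin_def by (rule sets_measure_of) (use sets.sets_into_space in blast)

lemma sets_le_adjoin: "sets N \<subseteq> sets (adjoin N X)"
proof
  fix F assume "F \<in> sets N"
  then have "F \<inter> X -` UNIV \<in> sets (adjoin N X)"
    unfolding sets_adjoin by (intro sigma_sets.Basic CollectI exI conjI) auto
  then show "F \<in> sets (adjoin N X)" by simp
qed

lemma measurable_adjoin: "X \<in> borel_measurable (adjoin N X)"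
proof (rule measurableI)
  fix U :: "'b set" assume "U \<in> sets borel"
  then show "X -` U \<inter> space (adjoin N X) \<in> sets (adjoin N X)"
    unfolding sets_adjoin by (intro sigma_sets.Basic) auto
qed simp

lemma sets_adjoin_le:
  assumes "space M = space N" and "sets N \<subseteq> sets M" and "X \<in> borel_measurable M"
  shows "sets (adjoin N X) \<subseteq> sets M"
  unfolding sets_adjoin assms(1)[symmetric]
proof (rule sets.sigma_sets_subset, clarify)
  fix F and U :: "'b set" assume F: "F \<in> sets N" and U: "U \<in> sets borel"
  have "F \<inter> (X -` U \<inter> space M) \<in> sets M"
    using F U assms by (intro sets.Int measurable_sets) auto
  moreover have "F \<inter> (X -` U \<inter> space M) = F \<inter> X -` U"
    using sets.sets_into_space[OF F] assms(1) by auto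
  ultimately show "F \<inter> X -` U \<in> sets M" by simp
qed

lemma measurable_adjoin_mono: "f \<in> measurable N M \<Longrightarrow> f \<in> measurable (adjoin N X) M"
  by (rule subsetD[OF measurable_mono]) (simp_all add: sets_le_adjoin)

lemma sets_traj_algebra_insert_input:
  "sets (traj_algebra \<Omega> x I u (insert j J)) = sets (adjoin (traj_algebra \<Omega> x I u J) (u j))"
proof (rule antisym)
  show "sets (traj_algebra \<Omega> x I u (insert j J)) \<subseteq> sets (adjoin (traj_algebra \<Omega> x I u J) (u j))"
    by (rule sets_traj_algebra_le) (auto intro: measurable_adjoin measurable_adjoin_mono
        measurable_traj_algebra_state measurable_traj_algebra_input)
  show "sets (adjoin (traj_algebra \<Omega> x I u J) (u j)) \<subseteq> sets (traj_algebra \<Omega> x I u (insert j J))"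
    by (intro sets_adjoin_le sets_traj_algebra_mono measurable_traj_algebra_input) (simp_all add: subset_insertI)
qed

lemma sets_traj_algebra_insert_state:
  "sets (traj_algebra \<Omega> x (insert i I) u J) = sets (adjoin (traj_algebra \<Omega> x I u J) (x i))"
proof (rule antisym)
  show "sets (traj_algebra \<Omega> x (insert i I) u J) \<subseteq> sets (adjoin (traj_algebra \<Omega> x I u J) (x i))"
    by (rule sets_traj_algebra_le) (auto intro: measurable_adjoin measurable_adjoin_mono
        measurable_traj_algebra_state measurable_traj_algebra_input)
  show "sets (adjoin (traj_algebra \<Omega> x I u J) (x i)) \<subseteq> sets (traj_algebra \<Omega> x (insert i I) u J)"
    by (intro sets_adjoin_le sets_traj_algebra_mono measurable_traj_algebra_state) (simp_all add: subset_insertI)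
qed

section \<open>Likelihood ratios\<close>

text \<open>A Radon-Nikodym derivative of \<open>Q\<close> with respect to \<open>P\<close> on
  \<open>N\<close>. Measurability of \<open>Z\<close> for \<open>N\<close> ties it to the
  information in \<open>N\<close>, so that it can be updated as \<open>N\<close> grows.\<close>

definition has_likelihood_ratio :: "'a measure \<Rightarrow> 'a measure \<Rightarrow> 'a measure \<Rightarrow> ('a \<Rightarrow> ennreal) \<Rightarrow> bool"
  where "has_likelihood_ratio Q P N Z \<longleftrightarrow> Z \<in> borel_measurable N \<and>
    (\<forall>F\<in>sets N. emeasure Q F = (\<integral>\<^sup>+\<omega>. Z \<omega> * indicator F \<omega> \<partial>P))"

text \<open>Restricted to \<open>N\<close>, the measure \<open>Q\<close> is \<open>P\<close> with
  density \<open>Z\<close>, and integrals of functions measurable for \<open>N\<close> do not notice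
  the restriction.\<close>

lemma likelihood_ratio_nn_integral:
  assumes Z: "has_likelihood_ratio Q P N Z"
    and sub: "subalgebra Q N" "subalgebra P N"
    and f: "f \<in> borel_measurable N"
  shows "(\<integral>\<^sup>+\<omega>. f \<omega> \<partial>Q) = (\<integral>\<^sup>+\<omega>. Z \<omega> * f \<omega> \<partial>P)"
proof -
  have Zm: "Z \<in> borel_measurable N"
    using Z by (simp add: has_likelihood_ratio_def)
  have "restr_to_subalg Q N = density (restr_to_subalg P N) Z"
  proof (rule measure_eqI)
    fix F assume "F \<in> sets (restr_to_subalg Q N)"
    then have F: "F \<in> sets N" by (simp add: sets_restr_to_subalg[OF sub(1)])
    have "emeasure (density (restr_to_subalg P N) Z) F
        = (\<integral>\<^sup>+\<omega>. Z \<omega> * indicator F \<omega> \<partial>restr_to_subalg P N)"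
      using F Zm by (intro emeasure_density) (auto simp: sets_restr_to_subalg sub measurable_in_subalg)
    also have "\<dots> = (\<integral>\<^sup>+\<omega>. Z \<omega> * indicator F \<omega> \<partial>P)"
      using F Zm by (intro nn_integral_subalgebra2[OF sub(2)]) simp
    also have "\<dots> = emeasure (restr_to_subalg Q N) F"
      using F Z by (simp add: has_likelihood_ratio_def emeasure_restr_to_subalg[OF sub(1)])
    finally show "emeasure (restr_to_subalg Q N) F = emeasure (density (restr_to_subalg P N) Z) F" ..
  qed (simp add: sets_restr_to_subalg sub)
  then have "(\<integral>\<^sup>+\<omega>. f \<omega> \<partial>restr_to_subalg Q N) = (\<integral>\<^sup>+\<omega>. f \<omega> \<partial>density (restr_to_subalg P N) Z)"
    by simp
  also have "\<dots> = (\<integral>\<^sup>+\<omega>. Z \<omega> * f \<omega> \<partial>restr_to_subalg P N)"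
    using f Zm by (intro nn_integral_density) (auto intro: measurable_in_subalg sub)
  finally show ?thesis
    using f Zm by (simp add: nn_integral_subalgebra2 sub)
qed

text \<open>Dynkin's argument: the restriction of \<open>Q\<close> and the candidate density are
  measures that agree on the intersection-stable generator of the join, which contains the whole
  space with finite mass.\<close>

lemma has_likelihood_ratio_adjoinI:
  assumes "finite_measure Q" and sub: "subalgebra Q N'" "subalgebra P N'"
    and N': "space N' = space N" "sets N' = sets (adjoin N X)"
    and Z: "Z \<in> borel_measurable N'"
    and eq: "\<And>F U. F \<in> sets N \<Longrightarrow> U \<in> sets borel \<Longrightarrow>
      emeasure Q (F \<inter> X -` U) = (\<integral>\<^sup>+\<omega>. Z \<omega> * indicator (F \<inter> X -` U) \<omega> \<partial>P)"
  shows "has_likelihood_ratio Q P N' Z"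
proof -
  interpret Q: finite_measure Q by fact
  let ?G = "{F \<inter> X -` U | F U. F \<in> sets N \<and> U \<in> sets borel}"
  let ?R = "density (restr_to_subalg P N') Z"
  have sets_N': "sets N' = sigma_sets (space N) ?G"
    by (simp add: N'(2) sets_adjoin)
  have G_sub: "?G \<subseteq> sets N'" unfolding sets_N' by auto
  have R: "emeasure ?R F = (\<integral>\<^sup>+\<omega>. Z \<omega> * indicator F \<omega> \<partial>P)" if F: "F \<in> sets N'" for F
  proof -
    have "emeasure ?R F = (\<integral>\<^sup>+\<omega>. Z \<omega> * indicator F \<omega> \<partial>restr_to_subalg P N')"
      using F Z by (intro emeasure_density) (auto simp: sets_restr_to_subalg sub measurable_in_subalg)
    also have "\<dots> = (\<integral>\<^sup>+\<omega>. Z \<omega> * indicator F \<omega> \<partial>P)"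
      using F Z by (intro nn_integral_subalgebra2[OF sub(2)]) simp
    finally show ?thesis .
  qed
  have "restr_to_subalg Q N' = ?R"
  proof (rule measure_eqI_generator_eq[where \<Omega> = "space N" and E = ?G and A = "\<lambda>_. space N"])
    show "Int_stable ?G"
    proof (rule Int_stableI, clarify)
      fix F F' and U U' :: "'b set"
      assume "F \<in> sets N" "F' \<in> sets N" "U \<in> sets borel" "U' \<in> sets borel"
      then show "\<exists>F'' U''. F \<inter> X -` U \<inter> (F' \<inter> X -` U') = F'' \<inter> X -` U'' \<and> F'' \<in> sets N \<and> U'' \<in> sets borel"
        by (intro exI[of _ "F \<inter> F'"] exI[of _ "U \<inter> U'"]) auto
    qed
    show "?G \<subseteq> Pow (space N)" using sets.sets_into_space by blast
    show "sets (restr_to_subalg Q N') = sigma_sets (space N) ?G"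
      by (simp add: sets_restr_to_subalg sub sets_N')
    show "sets ?R = sigma_sets (space N) ?G"
      by (simp add: sets_restr_to_subalg sub sets_N')
    fix E assume E: "E \<in> ?G"
    then have "E \<in> sets N'" using G_sub by blast
    then show "emeasure (restr_to_subalg Q N') E = emeasure ?R E"
      using E eq by (auto simp: emeasure_restr_to_subalg[OF sub(1)] R)
  next
    have "space N \<inter> X -` UNIV \<in> ?G"
      by (intro CollectI exI conjI) auto
    then show "range (\<lambda>_::nat. space N) \<subseteq> ?G" by simp
    show "emeasure (restr_to_subalg Q N') (space N) \<noteq> \<infinity>"
      using sets.top[of N'] by (simp add: N'(1) emeasure_restr_to_subalg[OF sub(1)])
  qed auto
  then have "emeasure Q F = (\<integral>\<^sup>+\<omega>. Z \<omega> * indicator F \<omega> \<partial>P)" if "F \<in> sets N'" for F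
    using that R emeasure_restr_to_subalg[OF sub(1) that] by simp
  with Z show ?thesis by (simp add: has_likelihood_ratio_def)
qed

section \<open>Noise independence in the closed loop\<close>

lemma closed_loopD:
  assumes "closed_loop \<Omega> x u \<pi> A B w P"
  shows "prob_space P" and "sets P = sets \<Omega>" and "space P = space \<Omega>"
    and "x t \<in> borel_measurable \<Omega>" and "u t \<in> borel_measurable \<Omega>"
    and "AE \<omega> in P. x 0 \<omega> = 0"
    and "AE \<omega> in P. x (Suc t) \<omega> = A *v x t \<omega> + B *v u t \<omega> + w t \<omega>"
    and "distributed P lborel (w t) (\<lambda>v. ennreal (std_gaussian_density v))"
  using assms unfolding closed_loop_def by (auto dest: sets_eq_imp_space_eq)

lemma closed_loop_subalgebra:
  assumes "closed_loop \<Omega> x u \<pi> A B w P"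
  shows "subalgebra P (traj_algebra \<Omega> x I u J)"
  unfolding subalgebra_def using closed_loopD[OF assms]
  by (auto intro: subsetD[OF sets_traj_algebra_le, rotated -1])

lemma closed_loop_noise_indep:
  assumes cl: "closed_loop \<Omega> x u \<pi> A B w P"
    and "U \<in> sets borel" and "F \<in> sets (traj_algebra \<Omega> x {..t} u {..t})"
  shows "measure P ((w t -` U \<inter> space P) \<inter> F) = measure P (w t -` U \<inter> space P) * measure P F"
proof -
  interpret prob_space P by (rule closed_loopD[OF cl])
  have "indep_set (sets (vimage_algebra (space \<Omega>) (w t) borel))
      (sets (traj_algebra \<Omega> x {..t} u {..t}))"
    using cl unfolding closed_loop_def by blast
  then show ?thesis
    using assms by (intro indep_setD) (auto simp: closed_loopD(3)[OF cl] in_vimage_algebra)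
qed

lemma closed_loop_noise_indep_var:
  fixes g :: "real ^ 'n \<Rightarrow> real"
  assumes cl: "closed_loop \<Omega> x u \<pi> A B w P"
    and g: "g \<in> borel_measurable borel"
    and Y: "Y \<in> borel_measurable (traj_algebra \<Omega> x {..t} u {..t})"
  shows "prob_space.indep_var P borel (\<lambda>\<omega>. g (w t \<omega>)) borel Y"
proof -
  let ?G = "traj_algebra \<Omega> x {..t} u {..t}"
  note clD = closed_loopD[OF cl]
  interpret prob_space P by fact
  have w: "w t \<in> borel_measurable P"
    using distributed_measurable[OF clD(8)] by simp
  have YP: "Y \<in> borel_measurable P"
    by (rule measurable_from_subalg[OF closed_loop_subalgebra[OF cl] Y])
  have "prob ((\<lambda>\<omega>. g (w t \<omega>)) -` U \<inter> space P \<inter> (Y -` V \<inter> space P))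
      = prob ((\<lambda>\<omega>. g (w t \<omega>)) -` U \<inter> space P) * prob (Y -` V \<inter> space P)"
    if "U \<in> sets borel" "V \<in> sets borel" for U V
  proof -
    have "g -` U \<in> sets borel" using measurable_sets[OF g that(1)] by simp
    moreover have "Y -` V \<inter> space P \<in> sets ?G"
      using measurable_sets[OF Y that(2)] by (simp add: clD(3))
    ultimately show ?thesis
      using closed_loop_noise_indep[OF cl, of "g -` U" "Y -` V \<inter> space P" t]
      by (simp add: vimage_comp comp_def)
  qed
  \<comment> \<open>Preimages of Borel sets already form a sigma-algebra, so the product rule for
    single preimages is all of independence.\<close>
  moreover have "sigma_sets (space P) {f -` U \<inter> space P | U. U \<in> sets borel}
      = {f -` U \<inter> space P | U. U \<in> sets borel}" for f :: "'a \<Rightarrow> real"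
    using sets_vimage_algebra2[of f "space P" borel] sets_vimage_algebra[of "space P" f borel] by simp
  moreover have gw: "(\<lambda>\<omega>. g (w t \<omega>)) \<in> borel_measurable P"
    by (rule measurable_compose[OF w g])
  ultimately show ?thesis
    unfolding indep_var_eq indep_sets2_eq using YP by (auto intro: measurable_sets)
qed

text \<open>Freezing: the sample point enters \<open>H\<close> through the noise and through data of
  the trajectory up to time \<open>t\<close>. By independence the latter can be held fixed while the
  noise is integrated out against its Gaussian density.\<close>

lemma closed_loop_noise_nn_integral:
  fixes w :: "nat \<Rightarrow> 'a \<Rightarrow> real ^ 'n"
  assumes cl: "closed_loop \<Omega> x u \<pi> A B w P"
    and H: "case_prod H \<in> borel_measurable (borel \<Otimes>\<^sub>M traj_algebra \<Omega> x {..t} u {..t})"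
  shows "(\<integral>\<^sup>+\<omega>. H (w t \<omega>) \<omega> \<partial>P)
    = (\<integral>\<^sup>+\<omega>. (\<integral>\<^sup>+v. ennreal (std_gaussian_density v) * H v \<omega> \<partial>lborel) \<partial>P)"
proof -
  let ?G = "traj_algebra \<Omega> x {..t} u {..t}"
  let ?W = "density lborel (\<lambda>v :: real ^ 'n. ennreal (std_gaussian_density v))"
  note clD = closed_loopD[OF cl]
  interpret prob_space P by fact
  have W: "distr P borel (w t) = ?W"
    using distributed_distr_eq_density[OF clD(8), of t] by (simp cong: distr_cong)
  have id: "(\<lambda>\<omega>. \<omega>) \<in> measurable P ?G"
    using closed_loop_subalgebra[OF cl] by (intro measurable_from_subalg[of P ?G]) auto
  have w: "w t \<in> borel_measurable P"
    using distributed_measurable[OF clD(8)] by simp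
  interpret W: prob_space ?W
    unfolding W[symmetric] by (rule prob_space_distr[OF w])
  interpret G: prob_space "distr P ?G (\<lambda>\<omega>. \<omega>)"
    by (rule prob_space_distr[OF id])
  interpret pair_sigma_finite ?W "distr P ?G (\<lambda>\<omega>. \<omega>)" ..
  \<comment> \<open>The noise is paired with the identity into the coarser measurable space;
    independence says exactly that the law of this pair factorises on rectangles.\<close>
  have joint: "distr P (borel \<Otimes>\<^sub>M ?G) (\<lambda>\<omega>. (w t \<omega>, \<omega>)) = ?W \<Otimes>\<^sub>M distr P ?G (\<lambda>\<omega>. \<omega>)"
  proof (rule pair_measure_eqI[symmetric])
    fix U F assume "U \<in> sets ?W" and "F \<in> sets (distr P ?G (\<lambda>\<omega>. \<omega>))"
    then have U: "U \<in> sets borel" and F: "F \<in> sets ?G" by auto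
    have "emeasure P (w t -` U \<inter> space P) * emeasure P F = emeasure P ((w t -` U \<inter> space P) \<inter> F)"
      unfolding emeasure_eq_measure closed_loop_noise_indep[OF cl U F] by (rule ennreal_mult'[symmetric]) simp
    moreover have "(\<lambda>\<omega>. (w t \<omega>, \<omega>)) -` (U \<times> F) \<inter> space P = (w t -` U \<inter> space P) \<inter> F"
      and "F \<inter> space P = F"
      using sets.sets_into_space[OF F] by (auto simp: clD(3))
    ultimately show "emeasure ?W U * emeasure (distr P ?G (\<lambda>\<omega>. \<omega>)) F
        = emeasure (distr P (borel \<Otimes>\<^sub>M ?G) (\<lambda>\<omega>. (w t \<omega>, \<omega>))) (U \<times> F)"
      unfolding W[symmetric] using U F w id by (simp add: emeasure_distr)
  qed (auto intro: W.sigma_finite_measure_axioms G.sigma_finite_measure_axioms cong: sets_pair_measure_cong)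
  have "(\<integral>\<^sup>+\<omega>. H (w t \<omega>) \<omega> \<partial>P) = (\<integral>\<^sup>+z. case_prod H z \<partial>distr P (borel \<Otimes>\<^sub>M ?G) (\<lambda>\<omega>. (w t \<omega>, \<omega>)))"
    using H w id by (subst nn_integral_distr) (auto intro!: measurable_Pair)
  also have "\<dots> = (\<integral>\<^sup>+\<omega>. (\<integral>\<^sup>+v. H v \<omega> \<partial>?W) \<partial>distr P ?G (\<lambda>\<omega>. \<omega>))"
    unfolding joint
  proof -
    have "sets (borel \<Otimes>\<^sub>M ?G) = sets (?W \<Otimes>\<^sub>M distr P ?G (\<lambda>\<omega>. \<omega>))"
      by (intro sets_pair_measure_cong) simp_all
    from H[unfolded measurable_cong_sets[OF this refl]]
    show "(\<integral>\<^sup>+z. case_prod H z \<partial>(?W \<Otimes>\<^sub>M distr P ?G (\<lambda>\<omega>. \<omega>)))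
        = (\<integral>\<^sup>+\<omega>. (\<integral>\<^sup>+v. H v \<omega> \<partial>?W) \<partial>distr P ?G (\<lambda>\<omega>. \<omega>))"
      by (subst nn_integral_snd[of "case_prod H", symmetric]) simp_all
  qed
  also have "\<dots> = (\<integral>\<^sup>+\<omega>. (\<integral>\<^sup>+v. H v \<omega> \<partial>?W) \<partial>P)"
  proof (rule nn_integral_distr[OF id])
    have meas: "(\<lambda>(\<omega>, v). H v \<omega>) \<in> borel_measurable (?G \<Otimes>\<^sub>M borel)"
      using measurable_pair_swap[OF H] by simp
    have "sets (?G \<Otimes>\<^sub>M borel) = sets (?G \<Otimes>\<^sub>M ?W)"
      by (intro sets_pair_measure_cong) simp_all
    from meas[unfolded measurable_cong_sets[OF this refl]]
    have "(\<lambda>\<omega>. \<integral>\<^sup>+v. H v \<omega> \<partial>?W) \<in> borel_measurable ?G"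
      by (rule W.borel_measurable_nn_integral)
    then show "(\<lambda>\<omega>. \<integral>\<^sup>+v. H v \<omega> \<partial>?W) \<in> borel_measurable (distr P ?G (\<lambda>\<omega>. \<omega>))"
      by simp
  qed
  also have "\<dots> = (\<integral>\<^sup>+\<omega>. (\<integral>\<^sup>+v. ennreal (std_gaussian_density v) * H v \<omega> \<partial>lborel) \<partial>P)"
  proof (rule nn_integral_cong)
    fix \<omega> assume "\<omega> \<in> space P"
    then have "(\<lambda>v. H v \<omega>) \<in> borel_measurable borel"
      using measurable_Pair1[OF H, of \<omega>] by (simp add: clD(3))
    then show "(\<integral>\<^sup>+v. H v \<omega> \<partial>?W) = (\<integral>\<^sup>+v. ennreal (std_gaussian_density v) * H v \<omega> \<partial>lborel)"
      by (intro nn_integral_density) auto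
  qed
  finally show ?thesis .
qed

section \<open>Change of the system matrix\<close>

lemma past_in_space: "past x u t \<omega> \<in> space (past_space t)"
  by (simp add: past_def past_space_def space_pair_measure space_PiM)

lemma measurable_past: "past x u t \<in> measurable (past_algebra \<Omega> x u t) (past_space t)"
  unfolding past_def[abs_def] past_space_def
  by (intro measurable_Pair measurable_restrict measurable_traj_algebra_state
      measurable_traj_algebra_input) auto

lemma measurable_policy_probability:
  assumes "control_policy \<pi>" and "U \<in> sets borel"
  shows "(\<lambda>\<omega>. LINT v:U|lborel. \<pi> t (past x u t \<omega>) v) \<in> borel_measurable (past_algebra \<Omega> x u t)"
proof -
  let ?N = "past_algebra \<Omega> x u t"
  have "(\<lambda>(\<omega>, v). \<pi> t (past x u t \<omega>) v) \<in> borel_measurable (?N \<Otimes>\<^sub>M borel)"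
  proof -
    have "(\<lambda>z. (past x u t (fst z), snd z)) \<in> measurable (?N \<Otimes>\<^sub>M borel) (past_space t \<Otimes>\<^sub>M borel)"
      by (intro measurable_Pair measurable_compose[OF measurable_fst measurable_past] measurable_snd)
    from measurable_compose[OF this, of "\<lambda>(h, v). \<pi> t h v" borel] assms(1)
    show ?thesis
      unfolding control_policy_def by (simp add: case_prod_beta)
  qed
  then have "(\<lambda>(\<omega>, v). indicator U v *\<^sub>R \<pi> t (past x u t \<omega>) v) \<in> borel_measurable (?N \<Otimes>\<^sub>M borel)"
    using assms(2) by (simp add: case_prod_beta)
  moreover have "sets (?N \<Otimes>\<^sub>M borel) = sets (?N \<Otimes>\<^sub>M lborel)"
    by (intro sets_pair_measure_cong) simp_all
  ultimately have "(\<lambda>(\<omega>, v). indicator U v *\<^sub>R \<pi> t (past x u t \<omega>) v) \<in> borel_measurable (?N \<Otimes>\<^sub>M lborel)"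
    using measurable_cong_sets by blast
  then show ?thesis
    unfolding set_lebesgue_integral_def by (rule lborel.borel_measurable_lebesgue_integral)
qed

lemma policy_probability_nonneg:
  assumes "control_policy \<pi>"
  shows "0 \<le> (LINT v:U|lborel. \<pi> t (past x u t \<omega>) v)"
proof -
  have "0 \<le> \<pi> t (past x u t \<omega>) v" for v
    using assms past_in_space[of x u t \<omega>] unfolding control_policy_def by blast
  then show ?thesis
    unfolding set_lebesgue_integral_def
    by (intro Bochner_Integration.integral_nonneg) simp
qed

text \<open>Integrating the conditional probability over a past event turns the almost sure identity
  of the policy into a formula for the generators of the join with \<open>u t\<close>.\<close>

lemma closed_loop_input_prob:
  assumes cl: "closed_loop \<Omega> x u \<pi> A B w P" and pol: "control_policy \<pi>"
    and F: "F \<in> sets (past_algebra \<Omega> x u t)" and U: "U \<in> sets borel"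
  shows "emeasure P (F \<inter> u t -` U)
    = (\<integral>\<^sup>+\<omega>. ennreal (LINT v:U|lborel. \<pi> t (past x u t \<omega>) v) * indicator F \<omega> \<partial>P)"
proof -
  let ?N = "past_algebra \<Omega> x u t"
  define k where "k \<omega> = (LINT v:U|lborel. \<pi> t (past x u t \<omega>) v)" for \<omega>
  let ?E = "{\<omega> \<in> space \<Omega>. u t \<omega> \<in> U}"
  note clD = closed_loopD[OF cl]
  interpret prob_space P by fact
  interpret finite_measure_subalgebra P ?N
    by standard (rule closed_loop_subalgebra[OF cl])
  have AE: "AE \<omega> in P. real_cond_exp P ?N (indicator ?E) \<omega> = k \<omega>"
    using cl U unfolding closed_loop_def k_def by blast
  have FP: "F \<in> sets P"
    using F subalg by (auto simp: subalgebra_def)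
  have E: "?E \<in> sets P"
    using measurable_sets[OF clD(5) U] by (simp add: clD(2) vimage_def Int_def conj_commute)
  have int: "integrable P (indicator ?E :: _ \<Rightarrow> real)"
    using E by (intro integrable_real_indicator) (simp_all add: emeasure_eq_measure)
  have k_meas: "k \<in> borel_measurable P"
    unfolding k_def[abs_def]
    by (rule measurable_from_subalg[OF subalg measurable_policy_probability[OF pol U]])
  have k_nonneg: "0 \<le> k \<omega>" for \<omega>
    unfolding k_def by (rule policy_probability_nonneg[OF pol])
  have k_int: "integrable P k"
    using real_cond_exp_int(1)[OF int] AE k_meas
    by (subst integrable_cong_AE[of _ _ "real_cond_exp P ?N (indicator ?E)"]) auto
  have FE: "F \<inter> u t -` U = F \<inter> ?E"
    using sets.sets_into_space[OF F] by auto
  have "measure P (F \<inter> ?E) = (\<integral>\<omega>. indicator F \<omega> * indicator ?E \<omega> \<partial>P)"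
    using FP E by (simp add: indicator_inter_arith[symmetric] sets.Int)
  also have "\<dots> = (\<integral>\<omega>\<in>F. real_cond_exp P ?N (indicator ?E) \<omega> \<partial>P)"
    using real_cond_exp_intA[OF int F] by (simp add: set_lebesgue_integral_def)
  also have "\<dots> = (\<integral>\<omega>. k \<omega> * indicator F \<omega> \<partial>P)"
    unfolding set_lebesgue_integral_def
    using AE FP k_meas by (intro integral_cong_AE) (auto simp: mult.commute)
  finally have "emeasure P (F \<inter> u t -` U) = ennreal (\<integral>\<omega>. k \<omega> * indicator F \<omega> \<partial>P)"
    by (simp add: FE emeasure_eq_measure)
  also have "\<dots> = (\<integral>\<^sup>+\<omega>. ennreal (k \<omega> * indicator F \<omega>) \<partial>P)"
    using k_int k_nonneg FP
    by (intro nn_integral_eq_integral[symmetric] integrable_real_mult_indicator) auto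
  also have "\<dots> = (\<integral>\<^sup>+\<omega>. ennreal (k \<omega>) * indicator F \<omega> \<partial>P)"
    by (intro nn_integral_cong) (auto simp: indicator_def)
  finally show ?thesis unfolding k_def .
qed

text \<open>The previous formula says that the policy probability is the likelihood ratio, on the
  past, of \<open>P\<close> cut down to the event that the input lies in \<open>U\<close>. The
  change of measure then extends it from events to nonnegative functions.\<close>

lemma closed_loop_input_nn_integral:
  assumes cl: "closed_loop \<Omega> x u \<pi> A B w P" and pol: "control_policy \<pi>"
    and f: "f \<in> borel_measurable (past_algebra \<Omega> x u t)" and U: "U \<in> sets borel"
  shows "(\<integral>\<^sup>+\<omega>. f \<omega> * indicator (u t -` U) \<omega> \<partial>P)
    = (\<integral>\<^sup>+\<omega>. f \<omega> * ennreal (LINT v:U|lborel. \<pi> t (past x u t \<omega>) v) \<partial>P)"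
proof -
  let ?N = "past_algebra \<Omega> x u t"
  let ?k = "\<lambda>\<omega>. ennreal (LINT v:U|lborel. \<pi> t (past x u t \<omega>) v)"
  let ?E = "u t -` U \<inter> space P"
  note clD = closed_loopD[OF cl]
  have sub: "subalgebra P ?N" by (rule closed_loop_subalgebra[OF cl])
  have E: "?E \<in> sets P"
    using measurable_sets[OF clD(5) U] by (simp add: clD(2,3))
  have fP: "f \<in> borel_measurable P" by (rule measurable_from_subalg[OF sub f])
  have "has_likelihood_ratio (density P (indicator ?E)) P ?N ?k"
    unfolding has_likelihood_ratio_def
  proof (intro conjI ballI)
    show "?k \<in> borel_measurable ?N"
      by (rule measurable_compose[OF measurable_policy_probability[OF pol U] measurable_ennreal])
    fix F assume F: "F \<in> sets ?N"
    then have FP: "F \<in> sets P" using sub by (auto simp: subalgebra_def)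
    have "emeasure (density P (indicator ?E)) F = emeasure P (F \<inter> ?E)"
      using FP E by (simp add: emeasure_density indicator_inter_arith[symmetric] Int_commute)
    also have "F \<inter> ?E = F \<inter> u t -` U"
      using sets.sets_into_space[OF FP] by auto
    finally show "emeasure (density P (indicator ?E)) F = (\<integral>\<^sup>+\<omega>. ?k \<omega> * indicator F \<omega> \<partial>P)"
      by (simp add: closed_loop_input_prob[OF cl pol F U])
  qed
  moreover have "subalgebra (density P (indicator ?E)) ?N"
    using sub by (simp add: subalgebra_def)
  ultimately have "(\<integral>\<^sup>+\<omega>. f \<omega> \<partial>density P (indicator ?E)) = (\<integral>\<^sup>+\<omega>. ?k \<omega> * f \<omega> \<partial>P)"
    using sub f by (rule likelihood_ratio_nn_integral)
  moreover have "(\<integral>\<^sup>+\<omega>. f \<omega> \<partial>density P (indicator ?E)) = (\<integral>\<^sup>+\<omega>. indicator ?E \<omega> * f \<omega> \<partial>P)"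
    using fP E by (intro nn_integral_density) auto
  moreover have "\<dots> = (\<integral>\<^sup>+\<omega>. f \<omega> * indicator (u t -` U) \<omega> \<partial>P)"
    by (intro nn_integral_cong) (auto simp: indicator_def)
  ultimately show ?thesis by (simp add: mult.commute)
qed

text \<open>The kernel of the input is the same function of the past under both laws. It can be
  inserted under \<open>Q\<close>, carried to \<open>P\<close> by the ratio on the past, and
  resolved again under \<open>P\<close>, so no new factor appears.\<close>

lemma likelihood_ratio_input_step:
  fixes u :: "nat \<Rightarrow> 'a \<Rightarrow> real ^ 'm"
  assumes clP: "closed_loop \<Omega> x u \<pi> A B w P" and clQ: "closed_loop \<Omega> x u \<pi> A' B w' Q"
    and pol: "control_policy \<pi>"
    and Z: "has_likelihood_ratio Q P (past_algebra \<Omega> x u t) Z"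
  shows "has_likelihood_ratio Q P (traj_algebra \<Omega> x {..t} u {..t}) Z"
proof (rule has_likelihood_ratio_adjoinI[where N = "past_algebra \<Omega> x u t" and X = "u t"])
  let ?N = "past_algebra \<Omega> x u t"
  have Zm: "Z \<in> borel_measurable ?N"
    using Z by (simp add: has_likelihood_ratio_def)
  show "finite_measure Q"
    using closed_loopD(1)[OF clQ] by (rule prob_space.finite_measure)
  have ins: "{..t} = insert t {..<t}" by auto
  show "sets (traj_algebra \<Omega> x {..t} u {..t}) = sets (adjoin ?N (u t))"
    unfolding sets_traj_algebra_insert_input[symmetric] ins ..
  show "Z \<in> borel_measurable (traj_algebra \<Omega> x {..t} u {..t})"
    by (rule measurable_traj_algebra_mono[OF Zm]) auto
  fix F and U :: "(real ^ 'm) set"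
  assume F: "F \<in> sets ?N" and U: "U \<in> sets borel"
  let ?k = "\<lambda>\<omega>. ennreal (LINT v:U|lborel. \<pi> t (past x u t \<omega>) v)"
  have k: "?k \<in> borel_measurable ?N"
    by (rule measurable_compose[OF measurable_policy_probability[OF pol U] measurable_ennreal])
  have "emeasure Q (F \<inter> u t -` U) = (\<integral>\<^sup>+\<omega>. ?k \<omega> * indicator F \<omega> \<partial>Q)"
    by (rule closed_loop_input_prob[OF clQ pol F U])
  also have "\<dots> = (\<integral>\<^sup>+\<omega>. Z \<omega> * (?k \<omega> * indicator F \<omega>) \<partial>P)"
    using k F by (intro likelihood_ratio_nn_integral[OF Z] closed_loop_subalgebra[OF clP]
        closed_loop_subalgebra[OF clQ]) auto
  also have "\<dots> = (\<integral>\<^sup>+\<omega>. Z \<omega> * indicator F \<omega> * ?k \<omega> \<partial>P)"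
    by (simp add: ac_simps)
  also have "\<dots> = (\<integral>\<^sup>+\<omega>. Z \<omega> * indicator F \<omega> * indicator (u t -` U) \<omega> \<partial>P)"
    using Zm F by (intro closed_loop_input_nn_integral[OF clP pol _ U, symmetric]) auto
  also have "\<dots> = (\<integral>\<^sup>+\<omega>. Z \<omega> * indicator (F \<inter> u t -` U) \<omega> \<partial>P)"
    by (simp add: indicator_inter_arith mult.assoc)
  finally show "emeasure Q (F \<inter> u t -` U) = (\<integral>\<^sup>+\<omega>. Z \<omega> * indicator (F \<inter> u t -` U) \<omega> \<partial>P)" .
qed (simp_all add: closed_loop_subalgebra[OF clP] closed_loop_subalgebra[OF clQ])

text \<open>The logarithm of the likelihood ratio of \<open>A + D\<close> to \<open>A\<close>. With \<open>r\<close> the residual under \<open>A\<close>,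
  each increment is \<open>(\<parallel>r\<parallel>\<^sup>2 - \<parallel>r - D x\<^sub>t\<parallel>\<^sup>2) / 2\<close>.\<close>

primrec log_likelihood ::
  "(nat \<Rightarrow> 'a \<Rightarrow> real ^ 'n) \<Rightarrow> (nat \<Rightarrow> 'a \<Rightarrow> real ^ 'm) \<Rightarrow> real ^ 'n ^ 'n \<Rightarrow> real ^ 'm ^ 'n \<Rightarrow>
    real ^ 'n ^ 'n \<Rightarrow> nat \<Rightarrow> 'a \<Rightarrow> real"
  where
    "log_likelihood x u A B D 0 \<omega> = 0"
  | "log_likelihood x u A B D (Suc t) \<omega> = log_likelihood x u A B D t \<omega>
      + ((x (Suc t) \<omega> - (A *v x t \<omega> + B *v u t \<omega>)) \<bullet> (D *v x t \<omega>) - (norm (D *v x t \<omega>))\<^sup>2 / 2)"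

lemma borel_measurable_matrix_vector [measurable (raw)]:
  assumes "f \<in> borel_measurable M"
  shows "(\<lambda>\<omega>. (C :: real ^ 'n ^ 'm) *v f \<omega>) \<in> borel_measurable M"
  by (rule measurable_compose[OF assms borel_measurable_continuous_onI])
     (rule matrix_vector_mult_linear_continuous_on)

lemma measurable_log_likelihood:
  "log_likelihood x u A B D t \<in> borel_measurable (past_algebra \<Omega> x u t)"
proof (induction t)
  case (Suc t)
  let ?N = "past_algebra \<Omega> x u (Suc t)"
  have [measurable]: "x t \<in> borel_measurable ?N" "x (Suc t) \<in> borel_measurable ?N" "u t \<in> borel_measurable ?N"
    by (auto intro: measurable_traj_algebra_state measurable_traj_algebra_input)
  have [measurable]: "log_likelihood x u A B D t \<in> borel_measurable ?N"
    by (rule measurable_traj_algebra_mono[OF Suc]) auto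
  show ?case
    unfolding log_likelihood.simps(2)[abs_def] by measurable
qed (simp add: log_likelihood.simps(1)[abs_def])

lemma nn_integral_std_gaussian_shift:
  fixes d :: "real ^ 'n"
  assumes [measurable]: "g \<in> borel_measurable borel"
  shows "(\<integral>\<^sup>+v. ennreal (std_gaussian_density v) * g (d + v) \<partial>lborel)
    = (\<integral>\<^sup>+v. ennreal (std_gaussian_density v) * (ennreal (exp (v \<bullet> d - (norm d)\<^sup>2 / 2)) * g v) \<partial>lborel)"
proof -
  have "(\<integral>\<^sup>+v. ennreal (std_gaussian_density v) * g (d + v) \<partial>lborel)
      = (\<integral>\<^sup>+v. ennreal (std_gaussian_density v) * g (d + v) \<partial>distr lborel borel ((+) (- d)))"
    by (simp add: lborel_distr_plus)
  also have "\<dots> = (\<integral>\<^sup>+v. ennreal (std_gaussian_density (v - d)) * g v \<partial>lborel)"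
    by (subst nn_integral_distr) simp_all
  finally show ?thesis
    by (simp add: std_gaussian_density_shift std_gaussian_density_nonneg ennreal_mult mult.assoc)
qed

text \<open>Given the trajectory up to time \<open>t\<close>, the next state is Gaussian with mean
  \<open>a\<close> under \<open>P\<close> and mean \<open>a + d\<close> under \<open>Q\<close>, with
  the same covariance. The new factor is the quotient of these densities, evaluated at the residual
  under \<open>A\<close>.\<close>

lemma likelihood_ratio_state_step:
  fixes x :: "nat \<Rightarrow> 'a \<Rightarrow> real ^ 'n"
  assumes clP: "closed_loop \<Omega> x u \<pi> A B w P" and clQ: "closed_loop \<Omega> x u \<pi> A' B w' Q"
    and Z: "has_likelihood_ratio Q P (traj_algebra \<Omega> x {..t} u {..t}) Z"
  defines "d \<equiv> \<lambda>\<omega>. (A' - A) *v x t \<omega>"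
  shows "has_likelihood_ratio Q P (past_algebra \<Omega> x u (Suc t))
    (\<lambda>\<omega>. Z \<omega> * ennreal (exp ((x (Suc t) \<omega> - (A *v x t \<omega> + B *v u t \<omega>)) \<bullet> d \<omega> - (norm (d \<omega>))\<^sup>2 / 2)))"
proof -
  let ?G = "traj_algebra \<Omega> x {..t} u {..t}"
  let ?N' = "past_algebra \<Omega> x u (Suc t)"
  define a where "a \<omega> = A *v x t \<omega> + B *v u t \<omega>" for \<omega>
  define R where "R v \<omega> = ennreal (exp (v \<bullet> d \<omega> - (norm (d \<omega>))\<^sup>2 / 2))" for v \<omega>
  note clPD = closed_loopD[OF clP] and clQD = closed_loopD[OF clQ]
  have Zm [measurable]: "Z \<in> borel_measurable ?G"
    using Z by (simp add: has_likelihood_ratio_def)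
  have [measurable]: "x t \<in> borel_measurable ?G" "u t \<in> borel_measurable ?G"
    by (auto intro: measurable_traj_algebra_state measurable_traj_algebra_input)
  have [measurable]: "a \<in> borel_measurable ?G" "d \<in> borel_measurable ?G"
    unfolding a_def[abs_def] d_def by measurable
  have a': "A' *v x t \<omega> + B *v u t \<omega> = a \<omega> + d \<omega>" for \<omega>
    by (simp add: a_def d_def matrix_vector_mult_diff_rdistrib)
  have "has_likelihood_ratio Q P ?N' (\<lambda>\<omega>. Z \<omega> * R (x (Suc t) \<omega> - a \<omega>) \<omega>)"
  proof (rule has_likelihood_ratio_adjoinI[where N = ?G and X = "x (Suc t)"])
    show "finite_measure Q"
      using clQD(1) by (rule prob_space.finite_measure)
    show "sets ?N' = sets (adjoin ?G (x (Suc t)))"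
      unfolding sets_traj_algebra_insert_state[symmetric] atMost_Suc lessThan_Suc_atMost ..
    have G_N': "f \<in> borel_measurable ?N'" if "f \<in> borel_measurable ?G" for f :: "'a \<Rightarrow> 'z :: topological_space"
      by (rule measurable_traj_algebra_mono[OF that]) auto
    have [measurable]: "x (Suc t) \<in> borel_measurable ?N'"
      by (auto intro: measurable_traj_algebra_state)
    have [measurable]: "Z \<in> borel_measurable ?N'" "a \<in> borel_measurable ?N'" "d \<in> borel_measurable ?N'"
      by (auto intro: G_N')
    show "(\<lambda>\<omega>. Z \<omega> * R (x (Suc t) \<omega> - a \<omega>) \<omega>) \<in> borel_measurable ?N'"
      unfolding R_def by measurable
    fix F and U :: "(real ^ 'n) set"
    assume [measurable]: "F \<in> sets ?G" "U \<in> sets borel"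
    have FP: "F \<in> sets P" "F \<in> sets Q"
      using \<open>F \<in> sets ?G\<close> closed_loop_subalgebra[OF clP, of "{..t}" "{..t}"]
        closed_loop_subalgebra[OF clQ, of "{..t}" "{..t}"] by (auto simp: subalgebra_def)
    have XU: "x (Suc t) -` U \<inter> space \<Omega> \<in> sets \<Omega>"
      using clPD(4) \<open>U \<in> sets borel\<close> by (rule measurable_sets)
    have FXU: "F \<inter> x (Suc t) -` U = F \<inter> (x (Suc t) -` U \<inter> space \<Omega>)"
      using sets.sets_into_space[OF FP(1)] clPD(3) by auto
    have "emeasure Q (F \<inter> x (Suc t) -` U) = (\<integral>\<^sup>+\<omega>. indicator (F \<inter> x (Suc t) -` U) \<omega> \<partial>Q)"
      unfolding FXU using FP XU clQD(2) by (intro nn_integral_indicator[symmetric]) auto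
    also have "\<dots> = (\<integral>\<^sup>+\<omega>. indicator F \<omega> * indicator U (a \<omega> + d \<omega> + w' t \<omega>) \<partial>Q)"
      by (rule nn_integral_cong_AE) (use clQD(7)[of t] in eventually_elim, simp add: a' indicator_def)
    also have "\<dots> = (\<integral>\<^sup>+\<omega>. (\<integral>\<^sup>+v. ennreal (std_gaussian_density v) *
        (indicator F \<omega> * indicator U (a \<omega> + d \<omega> + v)) \<partial>lborel) \<partial>Q)"
      by (rule closed_loop_noise_nn_integral[OF clQ]) measurable
    \<comment> \<open>With the noise integrated out, the integrand depends on the trajectory up to
      time \<open>t\<close> only, where the ratio is already known.\<close>
    also have "\<dots> = (\<integral>\<^sup>+\<omega>. Z \<omega> * (\<integral>\<^sup>+v. ennreal (std_gaussian_density v) *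
        (indicator F \<omega> * indicator U (a \<omega> + d \<omega> + v)) \<partial>lborel) \<partial>P)"
      by (intro likelihood_ratio_nn_integral[OF Z] closed_loop_subalgebra[OF clP]
          closed_loop_subalgebra[OF clQ]) measurable
    also have "\<dots> = (\<integral>\<^sup>+\<omega>. (\<integral>\<^sup>+v. ennreal (std_gaussian_density v) *
        (Z \<omega> * R v \<omega> * (indicator F \<omega> * indicator U (a \<omega> + v))) \<partial>lborel) \<partial>P)"
    proof (rule nn_integral_cong)
      fix \<omega>
      have "(\<integral>\<^sup>+v. ennreal (std_gaussian_density v) * (indicator F \<omega> * indicator U (a \<omega> + d \<omega> + v)) \<partial>lborel)
          = (\<integral>\<^sup>+v. ennreal (std_gaussian_density v) * (R v \<omega> * (indicator F \<omega> * indicator U (a \<omega> + v))) \<partial>lborel)"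
        using nn_integral_std_gaussian_shift[of "\<lambda>v. indicator F \<omega> * indicator U (a \<omega> + v)" "d \<omega>"]
        by (simp add: R_def add.assoc)
      then show "Z \<omega> * (\<integral>\<^sup>+v. ennreal (std_gaussian_density v) * (indicator F \<omega> * indicator U (a \<omega> + d \<omega> + v)) \<partial>lborel)
          = (\<integral>\<^sup>+v. ennreal (std_gaussian_density v) * (Z \<omega> * R v \<omega> * (indicator F \<omega> * indicator U (a \<omega> + v))) \<partial>lborel)"
        by (simp add: nn_integral_cmult[symmetric] R_def ac_simps)
    qed
    \<comment> \<open>Freezing is now read backwards: the integration variable becomes the noise
      under \<open>P\<close>, which is the residual of the next state.\<close>
    also have "\<dots> = (\<integral>\<^sup>+\<omega>. Z \<omega> * R (w t \<omega>) \<omega> * (indicator F \<omega> * indicator U (a \<omega> + w t \<omega>)) \<partial>P)"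
      by (rule closed_loop_noise_nn_integral[OF clP, symmetric]) (unfold R_def, measurable)
    also have "\<dots> = (\<integral>\<^sup>+\<omega>. Z \<omega> * R (x (Suc t) \<omega> - a \<omega>) \<omega> * indicator (F \<inter> x (Suc t) -` U) \<omega> \<partial>P)"
      by (rule nn_integral_cong_AE)
        (use clPD(7)[of t] in eventually_elim, simp add: a_def indicator_def)
    finally show "emeasure Q (F \<inter> x (Suc t) -` U)
        = (\<integral>\<^sup>+\<omega>. Z \<omega> * R (x (Suc t) \<omega> - a \<omega>) \<omega> * indicator (F \<inter> x (Suc t) -` U) \<omega> \<partial>P)" .
  qed (simp_all add: closed_loop_subalgebra[OF clP] closed_loop_subalgebra[OF clQ])
  then show ?thesis by (simp add: R_def a_def)
qed

text \<open>The initial state is deterministic under every system matrix, so all laws agree on its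
  sigma-algebra and the ratio starts at 1.\<close>

lemma closed_loop_initial_prob:
  assumes cl: "closed_loop \<Omega> x u \<pi> A B w P" and S: "S \<in> sets borel"
  shows "emeasure P (x 0 -` S \<inter> space \<Omega>) = indicator S 0"
proof -
  note clD = closed_loopD[OF cl]
  interpret prob_space P by fact
  have "x 0 -` S \<inter> space \<Omega> \<in> sets P"
    using measurable_sets[OF clD(4) S] by (simp add: clD(2))
  then have "emeasure P (x 0 -` S \<inter> space \<Omega>) = (\<integral>\<^sup>+\<omega>. indicator (x 0 -` S \<inter> space \<Omega>) \<omega> \<partial>P)"
    by simp
  also have "\<dots> = (\<integral>\<^sup>+\<omega>. indicator S 0 \<partial>P)"
    by (rule nn_integral_cong_AE)
      (use clD(6) AE_space in eventually_elim, simp add: indicator_def clD(3))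
  finally show ?thesis by (simp add: emeasure_space_1)
qed

lemma closed_loop_likelihood_ratio:
  assumes clP: "closed_loop \<Omega> x u \<pi> A B w P" and clQ: "closed_loop \<Omega> x u \<pi> A' B w' Q"
    and pol: "control_policy \<pi>"
  shows "has_likelihood_ratio Q P (past_algebra \<Omega> x u t)
    (\<lambda>\<omega>. ennreal (exp (log_likelihood x u A B (A' - A) t \<omega>)))"
proof (induction t)
  case 0
  \<comment> \<open>No input precedes time 0, so the past is generated by \<open>x 0\<close> alone
    and consists of its preimages.\<close>
  have "{x i -` S \<inter> space \<Omega> | i S. i \<in> {..0::nat} \<and> S \<in> sets borel} \<union>
      {u j -` S \<inter> space \<Omega> | j S. j \<in> {..<0::nat} \<and> S \<in> sets borel}
      = {x 0 -` S \<inter> space \<Omega> | S. S \<in> sets borel}"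
    by auto
  then have sets_0: "sets (past_algebra \<Omega> x u 0) = {x 0 -` S \<inter> space \<Omega> | S. S \<in> sets borel}"
    unfolding sets_traj_algebra
    using sets_vimage_algebra[of "space \<Omega>" "x 0" borel] sets_vimage_algebra2[of "x 0" "space \<Omega>" borel]
    by simp
  have "emeasure Q F = emeasure P F" "F \<in> sets P" if F: "F \<in> sets (past_algebra \<Omega> x u 0)" for F
  proof -
    obtain S where S: "F = x 0 -` S \<inter> space \<Omega>" "S \<in> sets borel"
      using F unfolding sets_0 by blast
    then show "emeasure Q F = emeasure P F"
      by (simp add: closed_loop_initial_prob[OF clP] closed_loop_initial_prob[OF clQ])
    show "F \<in> sets P"
      using F closed_loop_subalgebra[OF clP, of "{..0}" "{..<0}"] by (auto simp: subalgebra_def)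
  qed
  then show ?case
    by (simp add: has_likelihood_ratio_def)
next
  case (Suc t)
  from likelihood_ratio_state_step[OF clP clQ likelihood_ratio_input_step[OF clP clQ pol Suc]]
  show ?case
    by (simp add: exp_add ennreal_mult)
qed

section \<open>Second moments\<close>

definition square_integrable :: "'a measure \<Rightarrow> ('a \<Rightarrow> 'b :: euclidean_space) \<Rightarrow> bool"
  where "square_integrable M z \<longleftrightarrow> z \<in> borel_measurable M \<and> integrable M (\<lambda>\<omega>. (norm (z \<omega>))\<^sup>2)"

lemma square_integrable_measurable: "square_integrable M z \<Longrightarrow> z \<in> borel_measurable M"
  by (simp add: square_integrable_def)

lemma square_integrable_add:
  assumes "square_integrable M y" and "square_integrable M z"
  shows "square_integrable M (\<lambda>\<omega>. y \<omega> + z \<omega>)"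
proof -
  have [measurable]: "y \<in> borel_measurable M" "z \<in> borel_measurable M"
    using assms by (simp_all add: square_integrable_def)
  have bound: "(norm (y \<omega> + z \<omega>))\<^sup>2 \<le> 2 * (norm (y \<omega>))\<^sup>2 + 2 * (norm (z \<omega>))\<^sup>2" for \<omega>
  proof -
    have "(norm (y \<omega> + z \<omega>))\<^sup>2 \<le> (norm (y \<omega>) + norm (z \<omega>))\<^sup>2"
      by (intro power_mono norm_triangle_ineq) simp
    also have "\<dots> \<le> 2 * (norm (y \<omega>))\<^sup>2 + 2 * (norm (z \<omega>))\<^sup>2"
      using sum_squares_bound[of "norm (y \<omega>)" "norm (z \<omega>)"] by (simp add: power2_sum)
    finally show ?thesis .
  qed
  have "integrable M (\<lambda>\<omega>. (norm (y \<omega> + z \<omega>))\<^sup>2)"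
    by (rule Bochner_Integration.integrable_bound[of _ "\<lambda>\<omega>. 2 * (norm (y \<omega>))\<^sup>2 + 2 * (norm (z \<omega>))\<^sup>2"])
      (use assms bound in \<open>auto simp: square_integrable_def\<close>)
  then show ?thesis by (simp add: square_integrable_def)
qed

lemma square_integrable_bounded_linear:
  assumes "square_integrable M z" and T: "bounded_linear T"
  shows "square_integrable M (\<lambda>\<omega>. T (z \<omega>))"
proof -
  obtain K where K: "\<And>y. norm (T y) \<le> norm y * K"
    using bounded_linear.bounded[OF T] by blast
  have z: "z \<in> borel_measurable M"
    using assms by (simp add: square_integrable_def)
  have [measurable]: "(\<lambda>\<omega>. T (z \<omega>)) \<in> borel_measurable M"
    by (rule measurable_compose[OF z borel_measurable_continuous_onI])
      (rule linear_continuous_on[OF T])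
  have bound: "(norm (T (z \<omega>)))\<^sup>2 \<le> K\<^sup>2 * (norm (z \<omega>))\<^sup>2" for \<omega>
    using power_mono[OF K[of "z \<omega>"], of 2] by (simp add: power_mult_distrib mult.commute)
  have "integrable M (\<lambda>\<omega>. (norm (T (z \<omega>)))\<^sup>2)"
    by (rule Bochner_Integration.integrable_bound[of _ "\<lambda>\<omega>. K\<^sup>2 * (norm (z \<omega>))\<^sup>2"])
      (use assms bound in \<open>auto simp: square_integrable_def\<close>)
  then show ?thesis by (simp add: square_integrable_def)
qed

lemma integrable_inner_square_integrable:
  assumes "square_integrable M y" and "square_integrable M z"
  shows "integrable M (\<lambda>\<omega>. y \<omega> \<bullet> z \<omega>)"
proof (rule Bochner_Integration.integrable_bound[of _ "\<lambda>\<omega>. (norm (y \<omega>))\<^sup>2 + (norm (z \<omega>))\<^sup>2"])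
  have [measurable]: "y \<in> borel_measurable M" "z \<in> borel_measurable M"
    using assms by (simp_all add: square_integrable_def)
  show "(\<lambda>\<omega>. y \<omega> \<bullet> z \<omega>) \<in> borel_measurable M" by measurable
  show "integrable M (\<lambda>\<omega>. (norm (y \<omega>))\<^sup>2 + (norm (z \<omega>))\<^sup>2)"
    using assms by (simp add: square_integrable_def)
  have "\<bar>y \<omega> \<bullet> z \<omega>\<bar> \<le> (norm (y \<omega>))\<^sup>2 + (norm (z \<omega>))\<^sup>2" for \<omega>
    using Cauchy_Schwarz_ineq2[of "y \<omega>" "z \<omega>"] sum_squares_bound[of "norm (y \<omega>)" "norm (z \<omega>)"]
      mult_nonneg_nonneg[OF norm_ge_zero[of "y \<omega>"] norm_ge_zero[of "z \<omega>"]] by linarith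
  then show "AE \<omega> in M. norm (y \<omega> \<bullet> z \<omega>) \<le> norm ((norm (y \<omega>))\<^sup>2 + (norm (z \<omega>))\<^sup>2)"
    by simp
qed

lemma square_integrable_inner:
  "square_integrable M z \<Longrightarrow> square_integrable M (\<lambda>\<omega>. a \<bullet> z \<omega>)"
  by (rule square_integrable_bounded_linear[OF _ bounded_linear_inner_right])

lemma square_integrable_vec_nth:
  "square_integrable M z \<Longrightarrow> square_integrable M (\<lambda>\<omega>. (z \<omega> :: real ^ 'n) $ i)"
  by (rule square_integrable_bounded_linear[OF _ bounded_linear_vec_nth])

lemma square_integrable_scaleR_const:
  "square_integrable M f \<Longrightarrow> square_integrable M (\<lambda>\<omega>. f \<omega> *\<^sub>R a)" for f :: "'a \<Rightarrow> real"
  by (rule square_integrable_bounded_linear[OF _ bounded_linear_scaleR_left])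

lemma square_integrable_matrix:
  "square_integrable M z \<Longrightarrow> square_integrable M (\<lambda>\<omega>. (C :: real ^ 'n ^ 'm) *v z \<omega>)"
  by (rule square_integrable_bounded_linear[OF _ bounded_linear_matrix_vector])

lemma square_integrable_cong_AE:
  assumes "AE \<omega> in M. y \<omega> = z \<omega>" and y: "y \<in> borel_measurable M" and z: "square_integrable M z"
  shows "square_integrable M y"
proof -
  have "integrable M (\<lambda>\<omega>. (norm (y \<omega>))\<^sup>2) \<longleftrightarrow> integrable M (\<lambda>\<omega>. (norm (z \<omega>))\<^sup>2)"
    using assms square_integrable_measurable[OF z] by (intro integrable_cong_AE) auto
  with y z show ?thesis by (simp add: square_integrable_def)
qed

section \<open>Matrix-valued expectations through bilinear forms\<close>

lemma bounded_linear_bilinear_form: "bounded_linear (\<lambda>T. a \<bullet> ((T :: real ^ 'n ^ 'm) *v b))"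
  by (simp add: linear_conv_bounded_linear[symmetric] linearI matrix_vector_mult_add_rdistrib
      inner_add_right scaleR_matrix_vector_assoc[symmetric])

lemma matrix_eq_bilinearI:
  fixes M N :: "real ^ 'n ^ 'm"
  assumes "\<And>a b. a \<bullet> (M *v b) = a \<bullet> (N *v b)"
  shows "M = N"
  unfolding matrix_eq by (intro allI) (rule vector_eq_ldot[THEN iffD1], simp add: assms)

lemma borel_measurable_vec_nth:
  "f \<in> borel_measurable M \<Longrightarrow> (\<lambda>\<omega>. (f \<omega> :: real ^ 'n) $ i) \<in> borel_measurable M"
  by (rule measurable_compose[where g = "\<lambda>v. v $ i"]) (auto intro!: borel_measurable_continuous_onI continuous_intros)

text \<open>Expanding in elementary matrices reduces Bochner integrability of the matrix to products
  of coordinates, which are integrable by square integrability.\<close>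

lemma integrable_outer:
  fixes z :: "'a \<Rightarrow> real ^ 'n"
  assumes "square_integrable M z"
  shows "integrable M (\<lambda>\<omega>. outer (z \<omega>) (z \<omega>))"
proof -
  have "outer y y = (\<Sum>i\<in>UNIV. \<Sum>j\<in>UNIV. ((axis i 1 \<bullet> y) \<bullet> (axis j 1 \<bullet> y)) *\<^sub>R axis i (axis j 1))"
    for y :: "real ^ 'n"
  proof -
    have if_sum: "(\<Sum>j\<in>UNIV. if b then g j else 0) = (if b then sum g UNIV else 0)"
      for b and g :: "'n \<Rightarrow> real"
      by simp
    show ?thesis
      by (simp add: vec_eq_iff outer_def inner_axis') (simp add: axis_def if_distrib[of "\<lambda>v. v $ _"]
          if_distrib[of "\<lambda>r. _ * r"] if_sum cong: if_cong)
  qed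
  then show ?thesis
    using assms by (simp add: integrable_inner_square_integrable square_integrable_inner del: inner_real_def)
qed

text \<open>A bilinear form in the matrix is a bounded linear functional and commutes with the
  integral. Matrix identities can thus be checked on scalar expectations.\<close>

lemma inner_second_moment:
  fixes z :: "'a \<Rightarrow> real ^ 'n"
  assumes "square_integrable M z"
  shows "a \<bullet> (second_moment M z *v b) = (\<integral>\<omega>. (a \<bullet> z \<omega>) * (b \<bullet> z \<omega>) \<partial>M)"
proof -
  have "a \<bullet> (second_moment M z *v b) = (\<integral>\<omega>. a \<bullet> (outer (z \<omega>) (z \<omega>) *v b) \<partial>M)"
    unfolding second_moment_def
    by (rule integral_bounded_linear[OF bounded_linear_bilinear_form integrable_outer[OF assms], symmetric])
  then show ?thesis
    by (simp add: outer_matrix_vector inner_commute mult.commute)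
qed

section \<open>Moments and orthogonality of noise, inputs and states\<close>

lemma closed_loop_noise_moments:
  assumes cl: "closed_loop \<Omega> x u \<pi> A B w P"
  shows "has_bochner_integral P (\<lambda>\<omega>. w t \<omega> $ i) 0"
    and "has_bochner_integral P (\<lambda>\<omega>. w t \<omega> $ i * w t \<omega> $ j) (if i = j then 1 else 0)"
proof -
  have *: "has_bochner_integral P (\<lambda>\<omega>. g (w t \<omega>)) m"
    if "has_bochner_integral lborel (\<lambda>v. std_gaussian_density v * g v) m" "g \<in> borel_measurable borel"
    for g m
    using that distributed_integral[OF closed_loopD(8)[OF cl], of g t]
      distributed_integrable[OF closed_loopD(8)[OF cl], of g t]
    by (simp add: has_bochner_integral_iff std_gaussian_density_nonneg)
  show "has_bochner_integral P (\<lambda>\<omega>. w t \<omega> $ i) 0"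
    by (rule *[OF std_gaussian_moments(1)]) simp
  show "has_bochner_integral P (\<lambda>\<omega>. w t \<omega> $ i * w t \<omega> $ j) (if i = j then 1 else 0)"
    by (rule *[OF std_gaussian_moments(2)]) simp
qed

lemma closed_loop_noise_square_integrable:
  assumes cl: "closed_loop \<Omega> x u \<pi> A B w P"
  shows "square_integrable P (w t)"
proof -
  have "integrable P (\<lambda>\<omega>. \<Sum>i\<in>UNIV. w t \<omega> $ i * w t \<omega> $ i)"
    using closed_loop_noise_moments(2)[OF cl] by (intro Bochner_Integration.integrable_sum) (auto simp: has_bochner_integral_iff)
  moreover have "w t \<in> borel_measurable P"
    using distributed_measurable[OF closed_loopD(8)[OF cl]] by simp
  ultimately show ?thesis
    by (simp add: square_integrable_def dot_square_norm[symmetric] inner_vec_def)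
qed

text \<open>Independence factorises the expectation in each component and the noise has mean 0. Here
  \<open>Y\<close> may involve the current input too.\<close>

lemma closed_loop_noise_orthogonal:
  assumes cl: "closed_loop \<Omega> x u \<pi> A B w P"
    and Y: "Y \<in> borel_measurable (traj_algebra \<Omega> x {..t} u {..t})" "square_integrable P Y"
  shows "(\<integral>\<omega>. w t \<omega> \<bullet> Y \<omega> \<partial>P) = 0"
proof -
  interpret prob_space P by (rule closed_loopD[OF cl])
  have wY: "integrable P (\<lambda>\<omega>. w t \<omega> $ i * Y \<omega> $ i)" and "(\<integral>\<omega>. w t \<omega> $ i * Y \<omega> $ i \<partial>P) = 0" for i
  proof -
    have indep: "indep_var borel (\<lambda>\<omega>. w t \<omega> $ i) borel (\<lambda>\<omega>. Y \<omega> $ i)"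
      by (intro closed_loop_noise_indep_var[OF cl] borel_measurable_vec_nth[OF Y(1)]) simp
    have Yi: "integrable P (\<lambda>\<omega>. Y \<omega> $ i)"
      using square_integrable_vec_nth[OF Y(2), of i]
      by (auto simp: square_integrable_def intro: square_integrable_imp_integrable)
    have wi: "integrable P (\<lambda>\<omega>. w t \<omega> $ i)" "(\<integral>\<omega>. w t \<omega> $ i \<partial>P) = 0"
      using closed_loop_noise_moments(1)[OF cl] by (auto simp: has_bochner_integral_iff)
    show "integrable P (\<lambda>\<omega>. w t \<omega> $ i * Y \<omega> $ i)"
      by (rule indep_var_integrable[OF indep wi(1) Yi])
    show "(\<integral>\<omega>. w t \<omega> $ i * Y \<omega> $ i \<partial>P) = 0"
      using indep_var_lebesgue_integral[OF indep wi(1) Yi] wi(2) by simp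
  qed
  then show ?thesis
    by (simp add: inner_vec_def Bochner_Integration.integral_sum)
qed

text \<open>A factor known from the past can be moved inside the conditional expectation of the
  input, which vanishes. In contrast to the noise, \<open>Y\<close> stops at the current
  state.\<close>

lemma centered_input_orthogonal:
  fixes Y :: "'a \<Rightarrow> real ^ 'm"
  assumes cl: "closed_loop \<Omega> x u \<pi> A B w P" and cen: "centered_excitation \<Omega> x u P"
    and Y: "Y \<in> borel_measurable (past_algebra \<Omega> x u t)" "square_integrable P Y"
  shows "(\<integral>\<omega>. u t \<omega> \<bullet> Y \<omega> \<partial>P) = 0"
proof -
  let ?N = "past_algebra \<Omega> x u t"
  note clD = closed_loopD[OF cl]
  interpret prob_space P by fact
  interpret finite_measure_subalgebra P ?N
    by standard (rule closed_loop_subalgebra[OF cl])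
  have ut [measurable]: "u t \<in> borel_measurable P"
    using clD(5) measurable_cong_sets[OF clD(2) refl] by blast
  have u: "square_integrable P (u t)"
    using cen ut by (simp add: centered_excitation_def square_integrable_def)
  have "integrable P (\<lambda>\<omega>. Y \<omega> $ i * u t \<omega> $ i)" and "(\<integral>\<omega>. Y \<omega> $ i * u t \<omega> $ i \<partial>P) = 0" for i
  proof -
    have "square_integrable P (\<lambda>\<omega>. Y \<omega> $ i)" "square_integrable P (\<lambda>\<omega>. u t \<omega> $ i)"
      by (rule square_integrable_vec_nth[OF Y(2)], rule square_integrable_vec_nth[OF u])
    from integrable_inner_square_integrable[OF this]
    show int: "integrable P (\<lambda>\<omega>. Y \<omega> $ i * u t \<omega> $ i)" by simp
    have "AE \<omega> in P. real_cond_exp P ?N (\<lambda>\<omega>. u t \<omega> $ i) \<omega> = 0"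
      using cen unfolding centered_excitation_def by blast
    then have "(\<integral>\<omega>. Y \<omega> $ i * real_cond_exp P ?N (\<lambda>\<omega>. u t \<omega> $ i) \<omega> \<partial>P) = 0"
      by (intro integral_eq_zero_AE) auto
    moreover have "(\<lambda>\<omega>. Y \<omega> $ i) \<in> borel_measurable ?N"
      by (rule borel_measurable_vec_nth[OF Y(1)])
    ultimately show "(\<integral>\<omega>. Y \<omega> $ i * u t \<omega> $ i \<partial>P) = 0"
      using real_cond_exp_intg(2)[OF int _ borel_measurable_vec_nth[OF ut]] by simp
  qed
  then show ?thesis
    by (simp add: inner_vec_def Bochner_Integration.integral_sum mult.commute)
qed

lemma centered_state_square_integrable:
  assumes cl: "closed_loop \<Omega> x u \<pi> A B w P" and cen: "centered_excitation \<Omega> x u P"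
  shows "square_integrable P (u t)" and "square_integrable P (x t)"
proof -
  note clD = closed_loopD[OF cl]
  have meas: "x s \<in> borel_measurable P" "u s \<in> borel_measurable P" for s
    using clD(4,5)[of s] measurable_cong_sets[OF clD(2) refl] by blast+
  show u: "square_integrable P (u s)" for s
    using cen meas by (simp add: centered_excitation_def square_integrable_def)
  show "square_integrable P (x t)"
  proof (induction t)
    case 0
    show ?case
      by (rule square_integrable_cong_AE[OF clD(6) meas(1)]) (simp add: square_integrable_def)
  next
    case (Suc t)
    show ?case
      by (rule square_integrable_cong_AE[OF clD(7) meas(1)])
        (intro square_integrable_add square_integrable_matrix Suc u closed_loop_noise_square_integrable[OF cl])
  qed
qed

text \<open>The next state is a sum of three terms that are mutually orthogonal: the noise is
  orthogonal to state and input by independence, and the input to the state by centering. Only the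
  three diagonal terms survive.\<close>

lemma second_moment_recursion:
  fixes x :: "nat \<Rightarrow> 'a \<Rightarrow> real ^ 'n" and u :: "nat \<Rightarrow> 'a \<Rightarrow> real ^ 'm"
  assumes cl: "closed_loop \<Omega> x u \<pi> A B w P" and cen: "centered_excitation \<Omega> x u P"
  shows "second_moment P (x (s + 1)) = A ** second_moment P (x s) ** transpose A
    + B ** second_moment P (u s) ** transpose B + mat 1"
proof (rule matrix_eq_bilinearI)
  fix a b :: "real ^ 'n"
  let ?G = "traj_algebra \<Omega> x {..s} u {..s}"
  note clD = closed_loopD[OF cl]
  note sq = centered_state_square_integrable[OF cl cen] closed_loop_noise_square_integrable[OF cl]
  define p q where "p \<omega> = A *v x s \<omega>" and "q \<omega> = B *v u s \<omega>" for \<omega>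
  have p: "square_integrable P p" and q: "square_integrable P q" and w: "square_integrable P (w s)"
    unfolding p_def[abs_def] q_def[abs_def] by (intro square_integrable_matrix sq)+
  have [measurable]: "x s \<in> borel_measurable (past_algebra \<Omega> x u s)"
    "x s \<in> borel_measurable ?G" "u s \<in> borel_measurable ?G"
    by (auto intro: measurable_traj_algebra_state measurable_traj_algebra_input)
  have pG: "p \<in> borel_measurable ?G" and qG: "q \<in> borel_measurable ?G"
    and pN: "p \<in> borel_measurable (past_algebra \<Omega> x u s)"
    unfolding p_def[abs_def] q_def[abs_def] by measurable
  have int: "integrable P (\<lambda>\<omega>. (c \<bullet> y \<omega>) * (c' \<bullet> z \<omega>))"
    if "square_integrable P y" "square_integrable P z" for c c' and y z :: "'a \<Rightarrow> real ^ 'n"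
    using integrable_inner_square_integrable[OF square_integrable_inner[OF that(1), of c]
        square_integrable_inner[OF that(2), of c']] by simp
  have noise_cross: "(\<integral>\<omega>. (c \<bullet> w s \<omega>) * (c' \<bullet> y \<omega>) \<partial>P) = 0"
    if "square_integrable P y" "y \<in> borel_measurable ?G" for c c' and y :: "'a \<Rightarrow> real ^ 'n"
    \<comment> \<open>Choosing \<open>Y\<close> as a scalar multiple of the fixed vector
      \<open>c\<close> makes the inner product with the noise split into the two scalar
      factors.\<close>
    using closed_loop_noise_orthogonal[OF cl, of "\<lambda>\<omega>. (c' \<bullet> y \<omega>) *\<^sub>R c" s] that
    by (simp add: square_integrable_scaleR_const square_integrable_inner inner_commute mult.commute)
  have input_cross: "(\<integral>\<omega>. (c \<bullet> q \<omega>) * (c' \<bullet> p \<omega>) \<partial>P) = 0" for c c'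
    using centered_input_orthogonal[OF cl cen, of "\<lambda>\<omega>. (c' \<bullet> p \<omega>) *\<^sub>R (transpose B *v c)" s] p pN
    by (simp add: square_integrable_scaleR_const square_integrable_inner q_def
        inner_commute[of "u s _"] dot_lmul_matrix mult.commute)
  have noise: "(\<integral>\<omega>. (a \<bullet> w s \<omega>) * (b \<bullet> w s \<omega>) \<partial>P) = a \<bullet> b"
  proof -
    have "(\<integral>\<omega>. (a \<bullet> w s \<omega>) * (b \<bullet> w s \<omega>) \<partial>P)
        = (\<integral>\<omega>. (\<Sum>i\<in>UNIV. \<Sum>j\<in>UNIV. (a $ i * b $ j) * (w s \<omega> $ i * w s \<omega> $ j)) \<partial>P)"
      by (simp add: inner_vec_def sum_product ac_simps)
    also have "\<dots> = (\<Sum>i\<in>UNIV. \<Sum>j\<in>UNIV. (a $ i * b $ j) * (if i = j then 1 else 0))"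
      using closed_loop_noise_moments(2)[OF cl]
      by (simp add: has_bochner_integral_iff Bochner_Integration.integral_sum)
    also have "\<dots> = a \<bullet> b"
      by (simp add: inner_vec_def if_distrib[of "\<lambda>r. _ * r"] cong: if_cong)
    finally show ?thesis .
  qed
  have "a \<bullet> (second_moment P (x (s + 1)) *v b) = (\<integral>\<omega>. (a \<bullet> x (Suc s) \<omega>) * (b \<bullet> x (Suc s) \<omega>) \<partial>P)"
    using sq(2) by (simp add: inner_second_moment)
  \<comment> \<open>All nine products; each mixed one has the later variable first, in the order
    state, input, noise, to match the cross-term facts.\<close>
  also have "\<dots> = (\<integral>\<omega>. (a \<bullet> p \<omega>) * (b \<bullet> p \<omega>) + (a \<bullet> q \<omega>) * (b \<bullet> q \<omega>) + (a \<bullet> w s \<omega>) * (b \<bullet> w s \<omega>)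
      + (b \<bullet> q \<omega>) * (a \<bullet> p \<omega>) + (a \<bullet> q \<omega>) * (b \<bullet> p \<omega>)
      + (b \<bullet> w s \<omega>) * (a \<bullet> p \<omega>) + (a \<bullet> w s \<omega>) * (b \<bullet> p \<omega>)
      + (b \<bullet> w s \<omega>) * (a \<bullet> q \<omega>) + (a \<bullet> w s \<omega>) * (b \<bullet> q \<omega>) \<partial>P)"
  proof (rule integral_cong_AE)
    show "AE \<omega> in P. (a \<bullet> x (Suc s) \<omega>) * (b \<bullet> x (Suc s) \<omega>) =
      (a \<bullet> p \<omega>) * (b \<bullet> p \<omega>) + (a \<bullet> q \<omega>) * (b \<bullet> q \<omega>) + (a \<bullet> w s \<omega>) * (b \<bullet> w s \<omega>)
      + (b \<bullet> q \<omega>) * (a \<bullet> p \<omega>) + (a \<bullet> q \<omega>) * (b \<bullet> p \<omega>)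
      + (b \<bullet> w s \<omega>) * (a \<bullet> p \<omega>) + (a \<bullet> w s \<omega>) * (b \<bullet> p \<omega>)
      + (b \<bullet> w s \<omega>) * (a \<bullet> q \<omega>) + (a \<bullet> w s \<omega>) * (b \<bullet> q \<omega>)"
      using clD(7)[of s]
      by eventually_elim (simp add: p_def q_def inner_add_right algebra_simps)
    have [measurable]: "p \<in> borel_measurable P" "q \<in> borel_measurable P" "w s \<in> borel_measurable P"
      "x (Suc s) \<in> borel_measurable P"
      using p q w sq(2) by (simp_all add: square_integrable_def)
    show "(\<lambda>\<omega>. (a \<bullet> x (Suc s) \<omega>) * (b \<bullet> x (Suc s) \<omega>)) \<in> borel_measurable P"
      by measurable
    show "(\<lambda>\<omega>. (a \<bullet> p \<omega>) * (b \<bullet> p \<omega>) + (a \<bullet> q \<omega>) * (b \<bullet> q \<omega>) + (a \<bullet> w s \<omega>) * (b \<bullet> w s \<omega>)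
      + (b \<bullet> q \<omega>) * (a \<bullet> p \<omega>) + (a \<bullet> q \<omega>) * (b \<bullet> p \<omega>)
      + (b \<bullet> w s \<omega>) * (a \<bullet> p \<omega>) + (a \<bullet> w s \<omega>) * (b \<bullet> p \<omega>)
      + (b \<bullet> w s \<omega>) * (a \<bullet> q \<omega>) + (a \<bullet> w s \<omega>) * (b \<bullet> q \<omega>)) \<in> borel_measurable P"
      by measurable
  qed
  also have "\<dots> = (\<integral>\<omega>. (a \<bullet> p \<omega>) * (b \<bullet> p \<omega>) \<partial>P) + (\<integral>\<omega>. (a \<bullet> q \<omega>) * (b \<bullet> q \<omega>) \<partial>P) + a \<bullet> b"
    by (simp add: int p q w noise noise_cross input_cross pG qG)
  also have "(\<integral>\<omega>. (a \<bullet> p \<omega>) * (b \<bullet> p \<omega>) \<partial>P) = a \<bullet> ((A ** second_moment P (x s) ** transpose A) *v b)"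
    using inner_second_moment[OF sq(2), of "a v* A" s "b v* A"]
    by (simp add: p_def dot_lmul_matrix matrix_vector_mul_assoc[symmetric])
  also have "(\<integral>\<omega>. (a \<bullet> q \<omega>) * (b \<bullet> q \<omega>) \<partial>P) = a \<bullet> ((B ** second_moment P (u s) ** transpose B) *v b)"
    using inner_second_moment[OF sq(1), of "a v* B" s "b v* B"]
    by (simp add: q_def dot_lmul_matrix matrix_vector_mul_assoc[symmetric])
  finally show "a \<bullet> (second_moment P (x (s + 1)) *v b) =
      a \<bullet> ((A ** second_moment P (x s) ** transpose A + B ** second_moment P (u s) ** transpose B + mat 1) *v b)"
    by (simp add: matrix_vector_mult_add_rdistrib inner_add_right)
qed

section \<open>The lower bound\<close>

text \<open>Under \<open>A\<close> the residual is the noise, which is orthogonal to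
  \<open>D *v x t\<close>, so only the quadratic part of each increment has nonzero mean. The
  negative of this value is the relative entropy of the law under \<open>A\<close> with respect to
  that under \<open>A + D\<close>, on the past at time \<open>t\<close>.\<close>

lemma log_likelihood_expectation:
  assumes cl: "closed_loop \<Omega> x u \<pi> A B w P" and cen: "centered_excitation \<Omega> x u P"
  shows "has_bochner_integral P (log_likelihood x u A B D t)
    (- (\<Sum>s<t. (\<integral>\<omega>. (norm (D *v x s \<omega>))\<^sup>2 \<partial>P)) / 2)"
proof (induction t)
  case 0
  show ?case using has_bochner_integral_zero[of P] by (simp add: log_likelihood.simps(1)[abs_def])
next
  case (Suc t)
  note clD = closed_loopD[OF cl]
  let ?y = "\<lambda>\<omega>. D *v x t \<omega>"
  have y: "square_integrable P ?y"
    by (rule square_integrable_matrix[OF centered_state_square_integrable(2)[OF cl cen]])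
  have yG: "?y \<in> borel_measurable (traj_algebra \<Omega> x {..t} u {..t})"
    by (intro borel_measurable_matrix_vector measurable_traj_algebra_state) simp
  have wy: "has_bochner_integral P (\<lambda>\<omega>. w t \<omega> \<bullet> ?y \<omega>) 0"
    using integrable_inner_square_integrable[OF closed_loop_noise_square_integrable[OF cl] y]
      closed_loop_noise_orthogonal[OF cl yG y] by (simp add: has_bochner_integral_iff)
  have yy: "has_bochner_integral P (\<lambda>\<omega>. (norm (?y \<omega>))\<^sup>2) (\<integral>\<omega>. (norm (?y \<omega>))\<^sup>2 \<partial>P)"
    using y by (simp add: square_integrable_def has_bochner_integral_iff)
  have meas: "log_likelihood x u A B D (Suc t) \<in> borel_measurable P"
    by (rule measurable_from_subalg[OF closed_loop_subalgebra[OF cl] measurable_log_likelihood])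
  have sum: "has_bochner_integral P (\<lambda>\<omega>. log_likelihood x u A B D t \<omega> + (w t \<omega> \<bullet> ?y \<omega> - (norm (?y \<omega>))\<^sup>2 / 2))
      (- (\<Sum>s<t. (\<integral>\<omega>. (norm (D *v x s \<omega>))\<^sup>2 \<partial>P)) / 2 + (0 - (\<integral>\<omega>. (norm (?y \<omega>))\<^sup>2 \<partial>P) / 2))"
    by (intro has_bochner_integral_add has_bochner_integral_diff has_bochner_integral_divide_zero Suc wy yy)
  have AE: "AE \<omega> in P. log_likelihood x u A B D (Suc t) \<omega>
      = log_likelihood x u A B D t \<omega> + (w t \<omega> \<bullet> ?y \<omega> - (norm (?y \<omega>))\<^sup>2 / 2)"
    using clD(7)[of t] by eventually_elim simp
  have "has_bochner_integral P (log_likelihood x u A B D (Suc t))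
      (- (\<Sum>s<t. (\<integral>\<omega>. (norm (D *v x s \<omega>))\<^sup>2 \<partial>P)) / 2 + (0 - (\<integral>\<omega>. (norm (?y \<omega>))\<^sup>2 \<partial>P) / 2))"
    using sum has_bochner_integral_cong_AE[OF meas borel_measurable_has_bochner_integral[OF sum] AE] by blast
  then show ?case by (simp add: field_simps del: log_likelihood.simps)
qed

text \<open>The Donsker--Varadhan inequality for the test function \<open>c\<close> times the indicator of \<open>E\<close>,
  obtained by integrating \<open>exp y \<ge> 1 + y\<close>.\<close>

lemma change_of_measure_inequality:
  assumes "prob_space P" and "prob_space Q" and sub: "subalgebra Q N" "subalgebra P N"
    and ratio: "has_likelihood_ratio Q P N (\<lambda>\<omega>. ennreal (exp (L \<omega>)))"
    and L: "has_bochner_integral P L l"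
    and E: "E \<in> sets N"
  shows "c * measure P E + l \<le> ln (1 + (exp c - 1) * measure Q E)"
proof -
  interpret P: prob_space P by fact
  interpret Q: prob_space Q by fact
  \<comment> \<open>\<open>K\<close> is the mean under \<open>Q\<close> of the exponential of
    \<open>c\<close> times the indicator of \<open>E\<close>. Subtracting \<open>ln K\<close> in the
    exponent normalises the mean under \<open>P\<close> of \<open>?g\<close> to 1.\<close>
  define K where "K = 1 + (exp c - 1) * measure Q E"
  have E_meas: "E \<in> sets P" "E \<in> sets Q"
    using E sub by (auto simp: subalgebra_def)
  have [measurable]: "L \<in> borel_measurable P"
    using L by (rule borel_measurable_has_bochner_integral)
  have "K = (1 - measure Q E) + exp c * measure Q E"
    by (simp add: K_def algebra_simps)
  also have "\<dots> > 0"
    using Q.prob_le_1[of E] measure_nonneg[of Q E]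
    by (cases "measure Q E = 0") (auto intro!: add_nonneg_pos simp: zero_less_measure_iff)
  finally have K: "0 < K" .
  let ?h = "\<lambda>\<omega>. 1 + (exp c - 1) * indicator E \<omega> :: real"
  let ?g = "\<lambda>\<omega>. exp (L \<omega>) * ?h \<omega>"
  have h_eq: "?h \<omega> = exp (c * indicator E \<omega>)" for \<omega>
    by (simp add: indicator_def)
  have h_pos: "0 \<le> ?h \<omega>" for \<omega>
    unfolding h_eq by simp
  have "ennreal K = (\<integral>\<^sup>+\<omega>. ennreal (?h \<omega>) \<partial>Q)"
  proof -
    have "has_bochner_integral Q ?h (1 + (exp c - 1) * measure Q E)"
      using E_meas Q.prob_space
      by (intro has_bochner_integral_add has_bochner_integral_mult_right has_bochner_integral_real_indicator)
        (auto simp: has_bochner_integral_iff Q.emeasure_eq_measure)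
    then show ?thesis
      using h_pos by (simp add: K_def has_bochner_integral_iff nn_integral_eq_integral)
  qed
  also have "\<dots> = (\<integral>\<^sup>+\<omega>. ennreal (exp (L \<omega>)) * ennreal (?h \<omega>) \<partial>P)"
  proof (rule likelihood_ratio_nn_integral[OF ratio sub])
    have [measurable]: "E \<in> sets N" by (rule E)
    show "(\<lambda>\<omega>. ennreal (?h \<omega>)) \<in> borel_measurable N" by measurable
  qed
  also have "\<dots> = (\<integral>\<^sup>+\<omega>. ennreal (?g \<omega>) \<partial>P)"
    using h_pos by (simp add: ennreal_mult)
  finally have g_nn: "(\<integral>\<^sup>+\<omega>. ennreal (?g \<omega>) \<partial>P) = ennreal K" ..
  have g: "has_bochner_integral P ?g K"
    using E_meas h_pos K g_nn by (intro has_bochner_integral_nn_integral) auto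
  have lin: "has_bochner_integral P (\<lambda>\<omega>. 1 + (L \<omega> + c * indicator E \<omega>) - ln K) (1 + (l + c * measure P E) - ln K)"
    using L E_meas P.prob_space
    by (intro has_bochner_integral_add has_bochner_integral_diff has_bochner_integral_mult_right
        has_bochner_integral_real_indicator) (auto simp: has_bochner_integral_iff P.emeasure_eq_measure)
  have "1 + (L \<omega> + c * indicator E \<omega>) - ln K \<le> ?g \<omega> / K" for \<omega>
  proof -
    have "?g \<omega> / K = exp (L \<omega> + c * indicator E \<omega> - ln K)"
      unfolding h_eq using K by (simp add: exp_diff exp_add)
    then show ?thesis
      using exp_ge_add_one_self[of "L \<omega> + c * indicator E \<omega> - ln K"] by linarith
  qed
  then have "1 + (l + c * measure P E) - ln K \<le> K / K"
    using lin has_bochner_integral_divide_zero[OF g, of K]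
    by (metis (mono_tags, lifting) has_bochner_integral_iff integral_mono)
  then show ?thesis
    using K by (simp add: K_def)
qed

section \<open>An elementary bound for the binary relative entropy\<close>

lemma x_ln_x_ge_tangent:
  fixes d a :: real
  assumes "0 < d" and "0 < a"
  shows "d * ln d \<ge> d * (1 + ln a) - a"
proof -
  have "ln (a / d) \<le> a / d - 1"
    using assms by (intro ln_le_minus_one) simp
  then have "d * ln (a / d) \<le> a - d"
    using assms by (simp add: field_simps)
  then show ?thesis
    using assms by (simp add: ln_div algebra_simps)
qed

text \<open>For \<open>\<delta> \<le> 1 / 4\<close> the tangent estimates below leave
  \<open>ln 3 - ln 2 - 1 / 4\<close>, so \<open>1 / 3\<close> is precise enough.\<close>

lemma ln_3_halves_ge: "ln (3 / 2 :: real) \<ge> 1 / 3"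
  using ln_le_minus_one[of "2 / 3 :: real"] by (simp add: ln_div)

text \<open>The right-hand side is the relative entropy of the Bernoulli laws with parameters
  \<open>1 - \<delta>\<close> and \<open>\<delta>\<close>. In the proof, the convex function \<open>\<delta> ln \<delta>\<close> is replaced by its tangent at
  \<open>1/4\<close> if \<open>\<delta> \<le> 1/4\<close> and at \<open>1/2\<close> otherwise.\<close>

lemma binary_relative_entropy_ge:
  fixes \<delta> :: real
  assumes "0 < \<delta>" and "\<delta> < 1 / 3"
  shows "ln (1 / (3 * \<delta>)) \<le> (1 - 2 * \<delta>) * ln ((1 - \<delta>) / \<delta>)"
proof -
  \<comment> \<open>This is the difference of the two sides with all logarithms split.\<close>
  have "0 \<le> ln 3 + ((1 - 2 * \<delta>) * ln (1 - \<delta>) + 2 * (\<delta> * ln \<delta>))"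
  proof (cases "\<delta> \<le> 1 / 4")
    case True
    have "- ln (1 - \<delta>) \<le> 1 / (1 - \<delta>) - 1"
      using ln_le_minus_one[of "1 / (1 - \<delta>)"] assms by (simp add: ln_div)
    then have "- ((1 - 2 * \<delta>) * ln (1 - \<delta>)) \<le> (1 - 2 * \<delta>) * (1 / (1 - \<delta>) - 1)"
      using mult_left_mono[of "- ln (1 - \<delta>)" "1 / (1 - \<delta>) - 1" "1 - 2 * \<delta>"] assms by simp
    also have "\<dots> \<le> \<delta>"
      using assms zero_le_square[of "1 - \<delta>"] by (simp add: divide_simps algebra_simps)
    finally have 1: "(1 - 2 * \<delta>) * ln (1 - \<delta>) \<ge> - \<delta>" by simp
    have 2: "\<delta> * ln \<delta> \<ge> \<delta> * (1 - 2 * ln 2) - 1 / 4"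
      using x_ln_x_ge_tangent[of \<delta> "1 / 4"] assms ln_realpow[of 2 2] by (simp add: ln_div)
    \<comment> \<open>The collected coefficient \<open>4 * ln 2 - 1\<close> is positive because
      \<open>ln 2 \<ge> 1 / 2\<close>, so \<delta> may be replaced by its largest value.\<close>
    have "\<delta> * (4 * ln 2 - 1) \<le> 1 / 4 * (4 * ln 2 - 1)"
      using True ln_le_minus_one[of "1 / 2 :: real"] by (intro mult_right_mono) (auto simp: ln_div)
    moreover have "ln 3 - ln 2 \<ge> (1 / 3 :: real)"
      using ln_3_halves_ge by (simp add: ln_div)
    ultimately show ?thesis
      using 1 2 by (simp add: algebra_simps)
  next
    case False
    \<comment> \<open>With \<open>1 - 2 * \<delta> = 2 * (1 - \<delta>) - 1\<close> the expression
      becomes \<open>ln 3\<close> minus twice the binary entropy, minus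
      \<open>ln (1 - \<delta>)\<close>. Entropy is at most \<open>ln 2\<close>, and with
      \<open>ln (3 / 4)\<close> for the last logarithm the constants cancel exactly, which is why
      \<open>1 / 4\<close> is the splitting point.\<close>
    have 1: "\<delta> * ln \<delta> \<ge> \<delta> * (1 - ln 2) - 1 / 2"
      using x_ln_x_ge_tangent[of \<delta> "1 / 2"] assms by (simp add: ln_div)
    have 2: "(1 - \<delta>) * ln (1 - \<delta>) \<ge> (1 - \<delta>) * (1 - ln 2) - 1 / 2"
      using x_ln_x_ge_tangent[of "1 - \<delta>" "1 / 2"] assms by (simp add: ln_div)
    have "ln (1 - \<delta>) \<le> ln (3 / 4)"
      using False assms by simp
    also have "ln (3 / 4 :: real) = ln 3 - 2 * ln 2"
      using ln_realpow[of 2 2] by (simp add: ln_div)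
    finally show ?thesis
      using 1 2 by (simp add: algebra_simps)
  qed
  then show ?thesis
    using assms by (simp add: ln_div ln_mult algebra_simps)
qed

section \<open>The two-point argument and the choice of perturbation\<close>

lemma stable_fromD:
  assumes "stable_from P Ahat \<epsilon> \<delta> A \<tau>" and "\<tau> \<le> t" and "spectral_norm (A - A') \<le> 6 * sqrt 2 * \<epsilon>"
  shows "1 - \<delta> \<le> measure (P A') {\<omega> \<in> space (P A'). spectral_norm (Ahat t \<omega> - A') \<le> \<epsilon>}"
proof -
  let ?S = "{A'. spectral_norm (A - A') \<le> 6 * sqrt 2 * \<epsilon>}"
  let ?m = "\<lambda>A'. measure (P A') {\<omega> \<in> space (P A'). spectral_norm (Ahat t \<omega> - A') \<le> \<epsilon>}"
  have "1 - \<delta> \<le> (INF A'\<in>?S. ?m A')"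
    using assms(1,2) by (simp add: stable_from_def)
  also have "\<dots> \<le> ?m A'"
    using assms(3) by (intro cINF_lower bdd_belowI2[where m = 0]) auto
  finally show ?thesis .
qed

lemma sum_matrix_vector:
  "(\<Sum>s\<in>S. M s) *v b = (\<Sum>s\<in>S. (M s :: real ^ 'n ^ 'm) *v b)"
  by (induction S rule: infinite_finite_induct) (simp_all add: matrix_vector_mult_add_rdistrib)

text \<open>Two-point argument: under \<open>A\<close> and under a matrix at distance more than \<open>2 \<epsilon>\<close> from \<open>A\<close>
  the estimate has to be close to two different matrices.\<close>

lemma perturbation_energy_ge:
  fixes x :: "nat \<Rightarrow> 'a \<Rightarrow> real ^ 'n" and D :: "real ^ 'n ^ 'n"
  assumes alg: "algorithm \<Omega> x u \<pi> Ahat"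
    and cl: "\<And>A'. closed_loop \<Omega> x u \<pi> A' B (w A') (P A')"
    and cen: "centered_excitation \<Omega> x u (P A)"
    and stable: "stable_from P Ahat \<epsilon> \<delta> A \<tau>"
    and \<epsilon>: "0 < \<epsilon>" and \<delta>: "0 < \<delta>" "\<delta> < 1 / 3"
    and D: "2 * \<epsilon> < spectral_norm D" "spectral_norm D \<le> 6 * sqrt 2 * \<epsilon>"
  shows "ln (1 / (3 * \<delta>)) \<le> (\<Sum>s\<in>{1..<\<tau>}. (\<integral>\<omega>. (norm (D *v x s \<omega>))\<^sup>2 \<partial>P A)) / 2"
proof -
  define A' where "A' = A + D"
  let ?N = "past_algebra \<Omega> x u \<tau>"
  let ?E = "{\<omega> \<in> space \<Omega>. spectral_norm (Ahat \<tau> \<omega> - A) \<le> \<epsilon>}"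
  let ?E' = "{\<omega> \<in> space \<Omega>. spectral_norm (Ahat \<tau> \<omega> - A') \<le> \<epsilon>}"
  let ?v = "\<lambda>s. \<integral>\<omega>. (norm (D *v x s \<omega>))\<^sup>2 \<partial>P A"
  have pol: "control_policy \<pi>" and Ahat: "Ahat \<tau> \<in> borel_measurable ?N"
    using alg by (auto simp: algorithm_def)
  have sub: "subalgebra (P C) ?N" for C
    by (rule closed_loop_subalgebra[OF cl])
  have space: "space (P C) = space \<Omega>" for C
    by (rule closed_loopD(3)[OF cl])
  interpret Q: prob_space "P A'" by (rule closed_loopD(1)[OF cl])
  have ball: "{\<omega> \<in> space \<Omega>. spectral_norm (Ahat \<tau> \<omega> - C) \<le> \<epsilon>} \<in> sets ?N" for C
  proof -
    have "(\<lambda>\<omega>. spectral_norm (Ahat \<tau> \<omega> - C)) \<in> borel_measurable ?N"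
      using Ahat by measurable
    then have "{\<omega> \<in> space ?N. spectral_norm (Ahat \<tau> \<omega> - C) \<le> \<epsilon>} \<in> sets ?N"
      by measurable
    then show ?thesis by simp
  qed
  have ballP: "{\<omega> \<in> space \<Omega>. spectral_norm (Ahat \<tau> \<omega> - C) \<le> \<epsilon>} \<in> sets (P C')" for C C'
    using ball sub unfolding subalgebra_def by blast
  have p: "1 - \<delta> \<le> measure (P A) ?E"
    using stable_fromD[OF stable order_refl, of A] \<epsilon> by (simp add: space spectral_norm_def onorm_zero)
  have q: "measure (P A') ?E \<le> \<delta>"
  proof -
    have "1 - \<delta> \<le> measure (P A') ?E'"
      using stable_fromD[OF stable order_refl, of A'] D(2) spectral_norm_minus[of D]
      by (simp add: A'_def space)
    \<comment> \<open>An estimate close to both matrices would put them at distance at most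
      \<open>2 * \<epsilon>\<close>; the strict inequality for \<open>D\<close> excludes
      this.\<close>
    moreover have "?E \<inter> ?E' = {}"
    proof (rule equals0I, clarify)
      fix \<omega>
      let ?C = "Ahat \<tau> \<omega>"
      assume "spectral_norm (?C - A) \<le> \<epsilon>" and "spectral_norm (?C - A') \<le> \<epsilon>"
      moreover have "spectral_norm D \<le> spectral_norm (?C - A) + spectral_norm (?C - A')"
        using spectral_norm_triangle[of "?C - A" "- (?C - A')"] spectral_norm_minus[of "?C - A'"]
        by (simp add: A'_def)
      ultimately show False using D(1) by linarith
    qed
    then have "measure (P A') ?E + measure (P A') ?E' = measure (P A') (?E \<union> ?E')"
      by (intro Q.finite_measure_Union[symmetric] ballP)
    then have "measure (P A') ?E + measure (P A') ?E' \<le> 1"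
      using Q.prob_le_1 by simp
    ultimately show ?thesis by linarith
  qed
  \<comment> \<open>This maximises \<open>c * p - ln (1 + (exp c - 1) * q)\<close> at
    \<open>p = 1 - \<delta>\<close> and \<open>q = \<delta>\<close>, where
    \<open>exp c = p * (1 - q) / (q * (1 - p))\<close>; the maximum is the binary relative entropy.
    That \<open>c\<close> is nonnegative lets both probability bounds be used in the right
    direction.\<close>
  define c where "c = 2 * ln ((1 - \<delta>) / \<delta>)"
  have "1 < (1 - \<delta>) / \<delta>"
    using \<delta> by (simp add: field_simps)
  then have c: "0 \<le> c" by (simp add: c_def)
  have exp_c: "1 + (exp c - 1) * \<delta> = (1 - \<delta>) / \<delta>"
  proof -
    have "exp c = ((1 - \<delta>) / \<delta>)\<^sup>2"
      using \<delta> by (simp add: c_def exp_double)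
    then show ?thesis
      using \<delta> by (simp add: field_simps power2_eq_square)
  qed
  have AA': "A' - A = D" by (simp add: A'_def)
  have "c * measure (P A) ?E + - (\<Sum>s<\<tau>. ?v s) / 2 \<le> ln (1 + (exp c - 1) * measure (P A') ?E)"
    using closed_loop_likelihood_ratio[OF cl cl pol, where A = A and A' = A' and t = \<tau>]
      log_likelihood_expectation[OF cl cen, of D \<tau>] unfolding AA'
    by (intro change_of_measure_inequality[of "P A" "P A'" ?N] closed_loopD(1)[OF cl] sub ball)
  also have "\<dots> \<le> ln (1 + (exp c - 1) * \<delta>)"
    using q c by (intro ln_mono add_left_mono mult_left_mono add_pos_nonneg mult_nonneg_nonneg) auto
  finally have "c * (1 - \<delta>) - ln ((1 - \<delta>) / \<delta>) \<le> (\<Sum>s<\<tau>. ?v s) / 2"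
    using mult_left_mono[OF p c] unfolding exp_c by linarith
  then have "(1 - 2 * \<delta>) * ln ((1 - \<delta>) / \<delta>) \<le> (\<Sum>s<\<tau>. ?v s) / 2"
    by (simp add: c_def algebra_simps)
  \<comment> \<open>The likelihood runs over the times below \<tau>; the one at 0 has no energy
    since the initial state vanishes.\<close>
  moreover have "?v 0 = 0"
    using closed_loopD(6)[OF cl, of A] by (intro integral_eq_zero_AE) auto
  then have "(\<Sum>s<\<tau>. ?v s) = (\<Sum>s\<in>{1..<\<tau>}. ?v s)"
    by (intro sum.mono_neutral_right) (auto simp: not_less_eq_eq)
  ultimately show ?thesis
    using binary_relative_entropy_ge[OF \<delta>] by simp
qed

theorem proposition3:
  fixes \<Omega> :: "'a measure"
    and x :: "nat \<Rightarrow> 'a \<Rightarrow> real ^ 'n"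
    and u :: "nat \<Rightarrow> 'a \<Rightarrow> real ^ 'm"
    and \<pi> :: "nat \<Rightarrow> ('n, 'm) past \<Rightarrow> real ^ 'm \<Rightarrow> real"
    and Ahat :: "nat \<Rightarrow> 'a \<Rightarrow> real ^ 'n ^ 'n"
    and P :: "real ^ 'n ^ 'n \<Rightarrow> 'a measure"
    and w :: "real ^ 'n ^ 'n \<Rightarrow> nat \<Rightarrow> 'a \<Rightarrow> real ^ 'n"
    and A :: "real ^ 'n ^ 'n"
    and B :: "real ^ 'm ^ 'n"
    and \<epsilon> \<delta> :: real
  assumes "\<epsilon> > 0" and "0 < \<delta>" and "\<delta> < 1"
    and "algorithm \<Omega> x u \<pi> Ahat"
    and "\<And>A'. closed_loop \<Omega> x u \<pi> A' B (w A') (P A')"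
    and "locally_stable P Ahat \<epsilon> \<delta> A"
    and "centered_excitation \<Omega> x u (P A)"
  shows "lambda_min (\<Sum>s\<in>{1..<sample_complexity P Ahat \<epsilon> \<delta> A}. second_moment (P A) (x s))
           \<ge> 1 / (2 * \<epsilon>\<^sup>2) * ln (1 / (3 * \<delta>)) \<and>
         (\<forall>s. second_moment (P A) (x (s + 1)) =
              A ** second_moment (P A) (x s) ** transpose A +
              B ** second_moment (P A) (u s) ** transpose B + mat 1)"
proof (intro conjI allI)
  note cl = assms(5) and cen = assms(7)
  show "second_moment (P A) (x (s + 1)) = A ** second_moment (P A) (x s) ** transpose A +
      B ** second_moment (P A) (u s) ** transpose B + mat 1" for s
    by (rule second_moment_recursion[OF cl cen])
  define \<tau> where "\<tau> = sample_complexity P Ahat \<epsilon> \<delta> A"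
  \<comment> \<open>Local stability makes the set under \<open>LEAST\<close> nonempty, so its
    minimum satisfies the stability condition itself.\<close>
  have stable: "stable_from P Ahat \<epsilon> \<delta> A \<tau>"
    using assms(6) unfolding \<tau>_def sample_complexity_def locally_stable_def by (auto intro: LeastI)
  define S where "S = (\<Sum>s\<in>{1..<\<tau>}. second_moment (P A) (x s))"
  note sq = centered_state_square_integrable(2)[OF cl cen]
  have S_inner: "a \<bullet> (S *v b) = (\<Sum>s\<in>{1..<\<tau>}. \<integral>\<omega>. (a \<bullet> x s \<omega>) * (b \<bullet> x s \<omega>) \<partial>P A)" for a b
    by (simp add: S_def sum_matrix_vector inner_sum_right inner_second_moment[OF sq])
  have "transpose S = S"
  proof (rule matrix_eq_bilinearI)
    fix a b
    have "a \<bullet> (transpose S *v b) = b \<bullet> (S *v a)"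
      using inner_commute[of a "b v* S"] by (simp add: dot_lmul_matrix)
    then show "a \<bullet> (transpose S *v b) = a \<bullet> (S *v b)"
      by (simp add: S_inner mult.commute)
  qed
  then obtain v where v: "norm v = 1" and "S *v v = lambda_min S *\<^sub>R v"
    by (rule minimal_eigenvector_symmetric)
  then have "lambda_min S = v \<bullet> (S *v v)"
    by (simp add: dot_square_norm)
  \<comment> \<open>The minimal eigenvalue is the energy of the states along one direction, exactly
    what a rank-one perturbation in that direction measures.\<close>
  then have lam: "lambda_min S = (\<Sum>s\<in>{1..<\<tau>}. \<integral>\<omega>. (v \<bullet> x s \<omega>)\<^sup>2 \<partial>P A)"
    by (simp add: S_inner power2_eq_square)
  have "1 / (2 * \<epsilon>\<^sup>2) * ln (1 / (3 * \<delta>)) \<le> lambda_min S"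
  proof (cases "\<delta> < 1 / 3")
    case False
    then have "ln (1 / (3 * \<delta>)) \<le> 0"
      using assms(2) by (intro ln_le_zero_iff[THEN iffD2]) (auto simp: field_simps)
    then have "1 / (2 * \<epsilon>\<^sup>2) * ln (1 / (3 * \<delta>)) \<le> 0"
      by (intro mult_nonneg_nonpos) auto
    also have "0 \<le> lambda_min S"
      unfolding lam by (intro sum_nonneg Bochner_Integration.integral_nonneg) simp
    finally show ?thesis .
  next
    case True
    have bound: "ln (1 / (3 * \<delta>)) \<le> c\<^sup>2 * lambda_min S / 2"
      if c: "2 * \<epsilon> < c" "c \<le> 6 * sqrt 2 * \<epsilon>" for c
    proof -
      have "0 \<le> c" using c assms(1) by linarith
      note norm_D = spectral_norm_scaled_projection[OF v this]
      have "norm ((c *\<^sub>R outer v v) *v y) = c * \<bar>v \<bullet> y\<bar>" for y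
        using v \<open>0 \<le> c\<close> by (simp add: scaleR_matrix_vector_assoc[symmetric] outer_matrix_vector abs_mult)
      then have "ln (1 / (3 * \<delta>)) \<le> (\<Sum>s\<in>{1..<\<tau>}. \<integral>\<omega>. c\<^sup>2 * (v \<bullet> x s \<omega>)\<^sup>2 \<partial>P A) / 2"
        using perturbation_energy_ge[OF assms(4) cl cen stable assms(1,2) True, of "c *\<^sub>R outer v v"] c
        by (simp add: norm_D power_mult_distrib)
      then show ?thesis
        by (simp add: lam sum_distrib_left)
    qed
    have "1 \<le> sqrt 2" by simp
    then have "2 * \<epsilon> < 6 * sqrt 2 * \<epsilon>"
      using assms(1) by (intro mult_strict_right_mono) linarith+
    then have "\<forall>\<^sub>F c in at_right (2 * \<epsilon>). c < 6 * sqrt 2 * \<epsilon>"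
      by (intro eventually_at_rightI[of _ "6 * sqrt 2 * \<epsilon>"]) auto
    then have "\<forall>\<^sub>F c in at_right (2 * \<epsilon>). ln (1 / (3 * \<delta>)) \<le> c\<^sup>2 * lambda_min S / 2"
      using eventually_at_right_less by eventually_elim (rule bound, simp_all)
    moreover have "((\<lambda>c. c\<^sup>2 * lambda_min S / 2) \<longlongrightarrow> (2 * \<epsilon>)\<^sup>2 * lambda_min S / 2) (at_right (2 * \<epsilon>))"
      by (intro tendsto_intros) simp
    ultimately have "ln (1 / (3 * \<delta>)) \<le> (2 * \<epsilon>)\<^sup>2 * lambda_min S / 2"
      by (intro tendsto_lowerbound) auto
    then show ?thesis
      using assms(1) by (simp add: field_simps power2_eq_square)
  qed
  then show "1 / (2 * \<epsilon>\<^sup>2) * ln (1 / (3 * \<delta>))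
      \<le> lambda_min (\<Sum>s\<in>{1..<sample_complexity P Ahat \<epsilon> \<delta> A}. second_moment (P A) (x s))"
    by (simp add: S_def \<tau>_def)
qed

end
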